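(* Let $k\ge 0$ be an integer and let $a$ be a congruence class modulo $3$. The limit of the initial $\omega^k$ elements of $\mathscr{D}^a$ is equal to $k$ if $k-a\equiv 0\pmod{3}$; it is equal to $k+\delta(2)$ if $k-a\equiv 1\pmod{3}$; and it is equal to $k+2\delta(2)$ if $k-a\equiv 2\pmod{3}$.
   Context: Natural numbers are positive integers. The complexity $\|n\|$ of a natural number $n$ is the least number of $1$'s needed to write $n$ using any combination of addition and multiplication (with arbitrary parenthesization). The defect of $n$ is the real number $\delta(n)=\|n\|-3\log_3 n$; in particular $\delta(2)=2-3\log_3 2$. For $a$ a congruence class modulo $3$, $\mathscr{D}^a=\{\delta(n): \|n\|\equiv a \pmod 3,\ n\neq 1\}$. It is known that each $\mathscr{D}^a$ is a well-ordered subset of $\mathbb{R}$ of order type $\omega^\omega$. The limit of the initial $\omega^k$ elements of $\mathscr{D}^a$ means the supremum in $\mathbb{R}$ of the initial segment of $\mathscr{D}^a$ having order type $\omega^k$ (ordinal exponentiation, $\omega^0=1$). *)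

theory Defs
  imports Complex_Main "HOL-Number_Theory.Cong"
begin

subsection \<open>Integer complexity and defect\<close>

datatype ones_expr = One | Add ones_expr ones_expr | Mul ones_expr ones_expr

primrec ones_value :: "ones_expr \<Rightarrow> nat" where
  "ones_value One = 1"
| "ones_value (Add e f) = ones_value e + ones_value f"
| "ones_value (Mul e f) = ones_value e * ones_value f"

primrec num_ones :: "ones_expr \<Rightarrow> nat" where
  "num_ones One = 1"
| "num_ones (Add e f) = num_ones e + num_ones f"
| "num_ones (Mul e f) = num_ones e + num_ones f"

text \<open>Every positive number is the value of some expression (a sum of ones), and \<open>0\<close> is not;
  \<open>complexity\<close> and \<open>defect\<close> are only used at positive arguments.\<close>

definition complexity :: "nat \<Rightarrow> nat" where
  "complexity n = (LEAST m. \<exists>e. ones_value e = n \<and> num_ones e = m)"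

definition defect :: "nat \<Rightarrow> real" where
  "defect n = real (complexity n) - 3 * log 3 (real n)"

text \<open>A congruence class modulo \<open>3\<close> is given by an arbitrary integer representative \<open>a\<close>.\<close>

definition defect_set :: "int \<Rightarrow> real set" where
  "defect_set a = {defect n | n. n > 0 \<and> n \<noteq> 1 \<and> [int (complexity n) = a] (mod 3)}"


subsection \<open>Order type \<open>\<omega>\<^sup>k\<close>\<close>

text \<open>A well-order representing the ordinal \<open>\<omega>\<^sup>k\<close>, by the recursion
  \<open>\<omega>\<^sup>0 = 1\<close> and \<open>\<omega>\<^sup>k\<^sup>+\<^sup>1 = \<omega>\<^sup>k \<cdot> \<omega>\<close>. The ordinal product \<open>\<omega>\<^sup>k \<cdot> \<omega>\<close> consists of \<open>\<omega>\<close>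
  consecutive copies of \<open>\<omega>\<^sup>k\<close>; the head of a list says in which copy it lies. Thus
  \<open>omega_pow k\<close> is the (reflexive) lexicographic order on the lists of length \<open>k\<close>.\<close>

primrec omega_pow :: "nat \<Rightarrow> nat list rel" where
  "omega_pow 0 = {([], [])}"
| "omega_pow (Suc k) =
     {(x # xs, y # ys) | x xs y ys.
        (x < y \<and> xs \<in> Field (omega_pow k) \<and> ys \<in> Field (omega_pow k)) \<or>
        (x = y \<and> (xs, ys) \<in> omega_pow k)}"

lemma Field_omega_pow: "Field (omega_pow k) = {xs. length xs = k}"
proof (induction k)
  case 0
  then show ?case by (auto simp: Field_def)
next
  case (Suc k)
  show ?case
  proof
    show "Field (omega_pow (Suc k)) \<subseteq> {xs. length xs = Suc k}"
      using Suc by (force simp: Field_def)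
    show "{xs. length xs = Suc k} \<subseteq> Field (omega_pow (Suc k))"
    proof
      fix zs :: "nat list" assume "zs \<in> {xs. length xs = Suc k}"
      then obtain x xs where zs: "zs = x # xs" "xs \<in> Field (omega_pow k)"
        using Suc by (auto simp: length_Suc_conv)
      then have "(x # xs, Suc x # xs) \<in> omega_pow (Suc k)" by simp
      then show "zs \<in> Field (omega_pow (Suc k))" using zs(1) by (metis FieldI1)
    qed
  qed
qed

lemma omega_pow_eq_lexn: "omega_pow k = lexn less_than k \<union> Id_on {xs. length xs = k}"
proof (induction k)
  case 0
  then show ?case by auto
next
  case (Suc k)
  have "(us, vs) \<in> omega_pow (Suc k) \<longleftrightarrow>
      (us, vs) \<in> lexn less_than (Suc k) \<union> Id_on {xs. length xs = Suc k}" for us vs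
  proof (cases us; cases vs)
    fix x xs y ys assume *: "us = x # xs" "vs = y # ys"
    have "(us, vs) \<in> lexn less_than (Suc k) \<longleftrightarrow>
        (x < y \<and> length xs = k \<and> length ys = k) \<or>
        (x = y \<and> length xs = k \<and> length ys = k \<and> (xs, ys) \<in> lexn less_than k)"
      unfolding * by (auto simp: image_iff intro!: bexI[where x = "((x, xs), (y, ys))"])
    moreover have "(xs, ys) \<in> lexn less_than k \<Longrightarrow> length xs = k \<and> length ys = k"
      using lexn_length by blast
    ultimately show ?thesis
      unfolding * omega_pow.simps(2) Field_omega_pow
      by (auto simp: Suc Id_on_iff simp del: lexn.simps)
  qed (auto simp: Id_on_iff image_iff)
  then show ?case by (simp add: set_eq_iff del: lexn.simps omega_pow.simps)
qed

lemma Well_order_omega_pow: "Well_order (omega_pow k)"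
proof -
  have "(omega_pow k - Id) \<subseteq> lexn less_than k"
    by (auto simp: omega_pow_eq_lexn)
  then have wf: "wf (omega_pow k - Id)"
    using wf_lexn[OF wf_less_than] wf_subset by blast
  have refl: "refl_on (Field (omega_pow k)) (omega_pow k)"
    unfolding refl_on_def Field_omega_pow by (simp add: omega_pow_eq_lexn Id_on_iff)
  have trans: "trans (omega_pow k)"
  proof (rule transI)
    fix xs ys zs assume "(xs, ys) \<in> omega_pow k" "(ys, zs) \<in> omega_pow k"
    then show "(xs, zs) \<in> omega_pow k"
      unfolding omega_pow_eq_lexn Un_iff Id_on_iff
      using transD[OF lexn_transI[OF trans_less_than, of k], of xs ys zs] by metis
  qed
  have antisym: "antisym (omega_pow k)"
    by (rule antisymI) (metis DiffI pair_in_Id_conv wf wf_asym)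
  have total: "total_on (Field (omega_pow k)) (omega_pow k)"
  proof (induction k)
    case 0
    then show ?case by (auto simp: total_on_def Field_def)
  next
    case (Suc k)
    show ?case
      unfolding total_on_def
    proof (intro ballI impI)
      fix us vs assume "us \<in> Field (omega_pow (Suc k))" "vs \<in> Field (omega_pow (Suc k))" "us \<noteq> vs"
      then obtain x xs y ys where *: "us = x # xs" "vs = y # ys" "length xs = k" "length ys = k"
        unfolding Field_omega_pow by (auto simp: length_Suc_conv)
      then have "xs \<noteq> ys \<Longrightarrow> (xs, ys) \<in> omega_pow k \<or> (ys, xs) \<in> omega_pow k"
        using Suc by (auto simp: total_on_def Field_omega_pow)
      then show "(us, vs) \<in> omega_pow (Suc k) \<or> (vs, us) \<in> omega_pow (Suc k)"
        using * \<open>us \<noteq> vs\<close> by (cases x y rule: linorder_cases) (auto simp: Field_omega_pow)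
    qed
  qed
  show ?thesis
    using wf refl trans antisym total
    unfolding well_order_on_def linear_order_on_def partial_order_on_def preorder_on_def
    by (auto intro: FieldI1 FieldI2)
qed


subsection \<open>The limit of the initial \<open>\<omega>\<^sup>k\<close> elements\<close>

definition initial_segment :: "'a::linorder set \<Rightarrow> 'a set \<Rightarrow> bool" where
  "initial_segment A S \<longleftrightarrow> S \<subseteq> A \<and> (\<forall>x\<in>S. \<forall>y\<in>A. y < x \<longrightarrow> y \<in> S)"

text \<open>\<open>has_initial_limit A k L\<close> says that \<open>A\<close> has an initial segment of order type
  \<open>\<omega>\<^sup>k\<close>, that it is bounded, and that its supremum is \<open>L\<close>. The segment is
  unique, and hence so is \<open>L\<close>, by the lemmas below. It is automatically nonempty.\<close>

definition has_initial_limit :: "real set \<Rightarrow> nat \<Rightarrow> real \<Rightarrow> bool" where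
  "has_initial_limit A k L \<longleftrightarrow>
     (\<exists>S. initial_segment A S \<and> (relation_of (\<le>) S, omega_pow k) \<in> ordIso \<and> bdd_above S \<and> Sup S = L)"

lemma Field_relation_of_le: "Field (relation_of (\<le>) (S :: 'a::linorder set)) = S"
  by (auto simp: Field_def relation_of_def)

lemma initial_segment_order_type_unique:
  fixes A S T :: "'a::linorder set"
  assumes "initial_segment A S" "(relation_of (\<le>) S, r) \<in> ordIso"
    and "initial_segment A T" "(relation_of (\<le>) T, r) \<in> ordIso"
  shows "S = T"
proof -
  have sub: "S' = T'" if "initial_segment A S'" "initial_segment A T'" "S' \<subseteq> T'"
    "(relation_of (\<le>) S', r) \<in> ordIso" "(relation_of (\<le>) T', r) \<in> ordIso" for S' T' :: "'a set"
  proof (rule ccontr)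
    assume "S' \<noteq> T'"
    let ?R = "relation_of (\<le>) T'"
    have W: "Well_order ?R" using that(5) by (auto simp: ordIso_def)
    have "ofilter ?R S'"
      unfolding ofilter_def Field_relation_of_le
    proof (intro conjI ballI subsetI)
      fix x y assume "x \<in> S'" "y \<in> under ?R x"
      then have "y \<in> T'" "y \<le> x" by (auto simp: under_def relation_of_def)
      then show "y \<in> S'"
        using \<open>x \<in> S'\<close> that(1,2) by (auto simp: initial_segment_def order_le_less)
    qed (use that(3) in auto)
    then have "(Restr ?R S', ?R) \<in> ordLess"
      using ofilter_ordLess[OF W, of S'] \<open>S' \<noteq> T'\<close> that(3)
      by (auto simp: Field_relation_of_le)
    moreover have "Restr ?R S' = relation_of (\<le>) S'"
      using that(3) by (auto simp: relation_of_def)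
    ultimately show False
      using that(4,5) by (metis not_ordLess_ordIso ordIso_symmetric ordIso_transitive)
  qed
  have "S \<subseteq> T \<or> T \<subseteq> S" (is ?sub)
  proof (rule ccontr)
    assume "\<not> ?sub"
    then obtain x y where "x \<in> S" "x \<notin> T" "y \<in> T" "y \<notin> S" by blast
    then show False
      using assms(1,3) unfolding initial_segment_def by (cases x y rule: linorder_cases) auto
  qed
  then show ?thesis using sub[of S T] sub[of T S] assms by metis
qed

lemma has_initial_limit_unique:
  "has_initial_limit A k L \<Longrightarrow> has_initial_limit A k L' \<Longrightarrow> L = L'"
  unfolding has_initial_limit_def using initial_segment_order_type_unique by metis

end

theory Submission
  imports Defs "HOL-Analysis.Analysis"
begin

text \<open>
  Call a sum or product efficient if its complexity is the sum of the complexities of its two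
  operands. Apart from \<open>2\<close> and \<open>3\<close>, an efficient sum \<open>c + d\<close> with \<open>d \<le> c\<close> has defect at
  least \<open>\<delta>(c) + \<delta>(2)\<close>, and \<open>d\<close> is bounded in terms of the defect; efficient products add defects.
  Every number is an efficient product of efficient sums, so an induction on the defect in steps of
  \<open>\<delta>(2)\<close> shows that any sequence of numbers of bounded defect has a subsequence whose defects
  are constant or strictly increasing to a limit \<open>\<delta>(m) + j\<close> with \<open>j \<ge> 1\<close>, where \<open>\<parallel>m\<parallel> + j\<close> is congruent
  to the complexities along the subsequence. Hence \<open>\<D>\<^sup>a\<close> has no limits from the right, and its
  \<open>k\<close>-th derived set lies in the set of all \<open>\<delta>(m) + j\<close> with \<open>j \<ge> k\<close> and \<open>\<parallel>m\<parallel> + j \<equiv> a\<close>, whose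
  least element is the claimed limit \<open>L\<close>. Multiplication by \<open>3\<^sup>n + 1\<close> for \<open>n \<rightarrow> \<infinity>\<close> shows that \<open>L\<close>
  is attained in the \<open>k\<close>-th derived set. A set of reals below \<open>L\<close> without limits from the right whose
  \<open>k\<close>-th derived set is \<open>{L}\<close> has order type \<open>\<omega>\<^sup>k\<close>.
\<close>

subsection \<open>Efficient sums and products\<close>

lemma ones_value_pos: "ones_value e > 0"
  by (induction e) auto

lemma num_ones_pos: "num_ones e > 0"
  by (induction e) auto

lemma complexity_le: "complexity (ones_value e) \<le> num_ones e"
  unfolding complexity_def by (rule Least_le) blast

lemma complexity_witness:
  assumes "n > 0"
  shows "\<exists>e. ones_value e = n \<and> num_ones e = complexity n"
proof -
  have "\<exists>e. ones_value e = n"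
    using assms
  proof (induction n rule: nat_induct_non_zero)
    case 1
    show ?case by (rule exI[of _ ones_expr.One]) simp
  next
    case (Suc n)
    then obtain e where "ones_value e = n" by blast
    then show ?case by (intro exI[of _ "Add e ones_expr.One"]) simp
  qed
  then have "\<exists>m e. ones_value e = n \<and> num_ones e = m" by blast
  then show ?thesis unfolding complexity_def by (rule LeastI_ex)
qed

lemma complexity_add_le:
  assumes "m > 0" "n > 0"
  shows "complexity (m + n) \<le> complexity m + complexity n"
proof -
  obtain e f where "ones_value e = m" "num_ones e = complexity m"
    "ones_value f = n" "num_ones f = complexity n"
    using assms complexity_witness by blast
  then show ?thesis using complexity_le[of "Add e f"] by simp
qed

lemma complexity_mult_le:
  assumes "m > 0" "n > 0"
  shows "complexity (m * n) \<le> complexity m + complexity n"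
proof -
  obtain e f where "ones_value e = m" "num_ones e = complexity m"
    "ones_value f = n" "num_ones f = complexity n"
    using assms complexity_witness by blast
  then show ?thesis using complexity_le[of "Mul e f"] by simp
qed

lemma complexity_pos: "n > 0 \<Longrightarrow> complexity n > 0"
  using complexity_witness num_ones_pos by metis

lemma complexity_1 [simp]: "complexity (Suc 0) = 1"
  using complexity_le[of ones_expr.One] complexity_pos[of 1] by simp

text \<open>In an optimal expression both operands of the top operation must be optimal too, since
  replacing one by a shorter expression would shorten the whole. A factor 1 is impossible because it
  costs a 1 without changing the value.\<close>

lemma complexity_cases:
  assumes "n > 1"
  obtains (sum) a b where "0 < b" "b \<le> a" "n = a + b" "complexity n = complexity a + complexity b"
  | (prod) a b where "1 < a" "1 < b" "n = a * b" "complexity n = complexity a + complexity b"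
proof -
  obtain e where e: "ones_value e = n" "num_ones e = complexity n"
    using complexity_witness[of n] assms by auto
  show thesis
  proof (cases e)
    case One
    then show thesis using e assms by simp
  next
    case (Add f g)
    let ?a = "ones_value f" and ?b = "ones_value g"
    have "complexity (?a + ?b) = complexity ?a + complexity ?b"
      using complexity_add_le[of ?a ?b] complexity_le[of f] complexity_le[of g] e Add
        ones_value_pos by fastforce
    then show thesis
      using sum[of ?b ?a] sum[of ?a ?b] e Add ones_value_pos[of f] ones_value_pos[of g]
      by (cases "?b \<le> ?a") (auto simp: add.commute)
  next
    case (Mul f g)
    let ?a = "ones_value f" and ?b = "ones_value g"
    have eff: "complexity (?a * ?b) = complexity ?a + complexity ?b"
      using complexity_mult_le[of ?a ?b] complexity_le[of f] complexity_le[of g] e Mul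
        ones_value_pos by fastforce
    have "?a \<noteq> 1" "?b \<noteq> 1"
      using eff by auto
    then show thesis
      using prod[of ?a ?b] e Mul eff ones_value_pos[of f] ones_value_pos[of g] by simp
  qed
qed

lemma complexity_ge_2:
  assumes "n > 1"
  shows "complexity n \<ge> 2"
  using assms
proof (cases rule: complexity_cases)
  case (sum a b)
  then show ?thesis using complexity_pos[of a] complexity_pos[of b] by simp
next
  case (prod a b)
  then show ?thesis using complexity_pos[of a] complexity_pos[of b] by simp
qed

lemma complexity_ge_3:
  assumes "n > 2"
  shows "complexity n \<ge> 3"
proof -
  have "n > 1" using assms by simp
  then show ?thesis
  proof (cases rule: complexity_cases)
    case (sum a b)
    then show ?thesis using complexity_ge_2[of a] complexity_pos[of b] assms by force
  next
    case (prod a b)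
    then show ?thesis using complexity_ge_2[of a] complexity_ge_2[of b] by simp
  qed
qed

lemma complexity_2 [simp]: "complexity 2 = 2"
  using complexity_add_le[of 1 1] complexity_ge_2[of 2] by (simp add: numeral_2_eq_2)

lemma complexity_3 [simp]: "complexity 3 = 3"
  using complexity_add_le[of 2 1] complexity_ge_3[of 3] by simp

lemma complexity_pow3_le: "n > 0 \<Longrightarrow> complexity (3 ^ n) \<le> 3 * n"
proof (induction n rule: nat_induct_non_zero)
  case (Suc n)
  then show ?case using complexity_mult_le[of 3 "3 ^ n"] by simp
qed simp

subsection \<open>The defect\<close>

lemma defect_mult:
  assumes "m > 0" "n > 0" "complexity (m * n) = complexity m + complexity n"
  shows "defect (m * n) = defect m + defect n"
  using assms by (simp add: defect_def log_mult algebra_simps)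

lemma defect_add:
  assumes "c > 0" "complexity (c + d) = complexity c + complexity d"
  shows "defect (c + d) = defect c + (real (complexity d) - 3 * log 3 (1 + d / c))"
proof -
  have "real (c + d) = real c * (1 + d / c)" using assms(1) by (simp add: field_simps)
  then have "log 3 (real (c + d)) = log 3 c + log 3 (1 + d / c)"
    using assms(1) by (metis (no_types) add_pos_nonneg divide_nonneg_nonneg log_mult
        of_nat_0_le_iff of_nat_0_less_iff zero_less_one less_numeral_extra(3) order_less_irrefl)
  then show ?thesis using assms(2) by (simp add: defect_def)
qed

lemma defect_2: "defect 2 = 2 - 3 * log 3 2"
  by (simp add: defect_def)

lemma defect_3 [simp]: "defect 3 = 0"
  by (simp add: defect_def)

lemma defect_1 [simp]: "defect (Suc 0) = 1"
  by (simp add: defect_def)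

section \<open>Numerical bounds for \<delta>(2) and for logarithms of small ratios\<close>

lemma defect_2_pos: "0 < defect 2"
proof -
  have "3 * log 3 (2::real) = log 3 (2 ^ 3)" by (subst log_nat_power) auto
  also have "\<dots> < log 3 (3 ^ 2)" by (subst log_less_cancel_iff) auto
  also have "\<dots> = 2" by (subst log_nat_power) auto
  finally show ?thesis by (simp add: defect_2)
qed

lemma two_defect_2_less_1: "2 * defect 2 < 1"
proof -
  have "1 = log 3 (3::real)" by simp
  also have "\<dots> < log 3 (2 ^ 2)" by (subst log_less_cancel_iff) auto
  also have "\<dots> = 2 * log 3 (2::real)" by (subst log_nat_power) auto
  finally show ?thesis by (simp add: defect_2)
qed

lemma log3_le: "0 < x \<Longrightarrow> x \<le> y \<Longrightarrow> log 3 x \<le> log 3 (y::real)"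
  by simp

lemma log3_4_thirds: "log 3 (4/3) = 2 * log 3 (2::real) - 1"
proof -
  have "log 3 (4/3::real) = log 3 (2 ^ 2) - log 3 3" by (subst log_divide) auto
  also have "log 3 (2 ^ 2 :: real) = 2 * log 3 2" by (subst log_nat_power) auto
  finally show ?thesis by simp
qed

text \<open>Amounts to 2\<delta>(2) \<le> 2 - 3 log_3(5/3), the extreme case of adding 2 to some c
  \<ge> 3. The preceding identity does the same for adding 1, with equality.\<close>

lemma log3_5_thirds: "3 * log 3 (5/3) \<le> 6 * log 3 (2::real) - 2"
proof -
  have "3 * log 3 (5/3::real) = log 3 ((5/3) ^ 3)" by (subst log_nat_power) auto
  also have "\<dots> \<le> log 3 (2 ^ 6 / 3 ^ 2)" by (rule log3_le) (auto simp: field_simps)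
  also have "\<dots> = log 3 (2 ^ 6) - log 3 (3 ^ 2)" by (subst log_divide) auto
  also have "log 3 (2 ^ 6 :: real) = 6 * log 3 2" by (subst log_nat_power) auto
  also have "log 3 (3 ^ 2 :: real) = 2" by (subst log_nat_power) auto
  finally show ?thesis .
qed

text \<open>Adding d to c changes the defect by t = \<parallel>d\<parallel> - 3 log_3(1 + d/c), and
  d \<le> c gives t \<ge> \<parallel>d\<parallel> - 2 + \<delta>(2). This suffices except for d = 1
  or d = 2 with c \<ge> 3, where d/c is at most 1/3 or 2/3. The third claim leaves only finitely
  many d once the defect of the sum is bounded.\<close>

lemma defect_efficient_sum:
  assumes "0 < d" "d \<le> c" "c + d > 3" "complexity (c + d) = complexity c + complexity d"
  shows "defect c + defect 2 \<le> defect (c + d)"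
    and "0 \<le> defect c \<Longrightarrow> 2 * defect 2 \<le> defect (c + d)"
    and "real (complexity d) \<le> defect (c + d) - defect c + 2"
proof -
  define t where "t = real (complexity d) - 3 * log 3 (1 + d / c)"
  have def: "defect (c + d) = defect c + t"
    unfolding t_def using assms by (intro defect_add) auto
  have l2: "log 3 (1 + d / c) \<le> log 3 2"
    using assms by (intro log3_le) (auto simp: field_simps add_pos_nonneg)
  consider "d = 1" "c \<ge> 3" | "d = 2" "c = 2" | "d = 2" "c \<ge> 3" | "d \<ge> 3"
    using assms by linarith
  \<comment> \<open>Apart from 2 + 2 the increment t alone reaches 2\<delta>(2); for 2 + 2 the
    missing \<delta>(2) is the defect of c itself.\<close>
  then have "defect 2 \<le> t \<and> (0 \<le> defect c \<longrightarrow> 2 * defect 2 \<le> defect c + t)"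
  proof cases
    case 1
    then have "log 3 (1 + d / c) \<le> log 3 (4/3)"
      by (intro log3_le) (auto simp: field_simps add_pos_nonneg)
    then have "2 * defect 2 \<le> t" using 1 log3_4_thirds by (simp add: t_def defect_2)
    then show ?thesis using defect_2_pos by simp
  next
    case 2
    then show ?thesis by (simp add: t_def defect_2)
  next
    case 3
    then have "log 3 (1 + d / c) \<le> log 3 (5/3)"
      by (intro log3_le) (auto simp: field_simps add_pos_nonneg)
    then have "2 * defect 2 \<le> t" using 3 log3_5_thirds by (simp add: t_def defect_2)
    then show ?thesis using defect_2_pos by simp
  next
    case 4
    then have "complexity d \<ge> 3" using complexity_ge_3[of d] by simp
    then have "1 + defect 2 \<le> t" using l2 by (simp add: t_def defect_2)
    then show ?thesis using defect_2_pos two_defect_2_less_1 by simp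
  qed
  then show "defect c + defect 2 \<le> defect (c + d)"
    "0 \<le> defect c \<Longrightarrow> 2 * defect 2 \<le> defect (c + d)"
    by (simp_all add: def)
  show "real (complexity d) \<le> defect (c + d) - defect c + 2"
    using l2 defect_2_pos by (simp add: def t_def defect_2)
qed

lemma defect_nonneg: "n > 0 \<Longrightarrow> 0 \<le> defect n"
proof (induction n rule: less_induct)
  case (less n)
  show ?case
  proof (cases "n > 1")
    case False
    then have "n = Suc 0" using less.prems by simp
    then show ?thesis by simp
  next
    case True
    then show ?thesis
    proof (cases rule: complexity_cases)
      case (sum a b)
      consider "n = 2" | "n = 3" | "n > 3" using True by linarith
      then show ?thesis
      proof cases
        case 3
        then show ?thesis
          using sum defect_efficient_sum(1)[of b a] less.IH[of a] defect_2_pos by force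
      qed (use defect_2_pos in auto)
    next
      case (prod a b)
      then show ?thesis using less.IH[of a] less.IH[of b] by (simp add: defect_mult)
    qed
  qed
qed

text \<open>Nonnegativity of the defect says n \<le> 3^\<parallel>n\<parallel>.\<close>

lemma finite_complexity_le: "finite {n. n > 0 \<and> complexity n \<le> M}"
proof (rule finite_subset)
  show "{n. n > 0 \<and> complexity n \<le> M} \<subseteq> {..3 ^ M}"
  proof safe
    fix n assume n: "n > 0" "complexity n \<le> M"
    have "log 3 (real n) \<le> real M"
      using defect_nonneg[OF n(1)] n(2) unfolding defect_def by linarith
    then have "real n \<le> 3 powr (real M)" using n by (simp add: log_le_iff)
    then show "n \<le> 3 ^ M" by (simp add: powr_realpow flip: of_nat_le_iff)
  qed
qed simp

text \<open>The residue of -\<parallel>n\<parallel> is subadditive over efficient products, just as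
  the defect is additive. An efficient sum above 3 already has defect at least 2\<delta>(2), the
  largest value the left side can take. This is the source of the terms \<delta>(2) and 2\<delta>(2)
  in the final limits.\<close>

lemma defect_residue:
  assumes "n > 0"
  shows "real_of_int ((- int (complexity n)) mod 3) * defect 2 \<le> defect n"
  using assms
proof (induction n rule: less_induct)
  case (less n)
  have mod_le: "(x mod 3 :: int) \<le> 2" for x :: int
    using pos_mod_bound[of 3 x] by linarith
  show ?case
  proof (cases "n > 1")
    case False
    then have "n = Suc 0" using less.prems by simp
    then show ?thesis using two_defect_2_less_1 by simp
  next
    case True
    then show ?thesis
    proof (cases rule: complexity_cases)
      case (sum a b)
      consider "n = 2" | "n = 3" | "n > 3" using True by linarith
      then show ?thesis
      proof cases
        case 3
        then have "2 * defect 2 \<le> defect n"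
          using sum defect_efficient_sum(2)[of b a] defect_nonneg[of a] by force
        moreover have "real_of_int ((- int (complexity n)) mod 3) * defect 2 \<le> 2 * defect 2"
          using defect_2_pos mod_le[of "- int (complexity n)"] by (intro mult_right_mono) auto
        ultimately show ?thesis by linarith
      qed auto
    next
      case (prod a b)
      let ?r = "\<lambda>n. (- int (complexity n)) mod 3"
      have "?r n \<le> ?r a + ?r b" using prod by (simp) presburger
      then have "real_of_int (?r n) * defect 2 \<le> (?r a + ?r b) * defect 2"
        using defect_2_pos by (intro mult_right_mono) auto
      then show ?thesis using less.IH[of a] less.IH[of b] prod
        by (simp add: defect_mult algebra_simps)
    qed
  qed
qed

text \<open>Keep splitting the left factor until it is an efficient sum, and collect all other
  factors into the cofactor c.\<close>

lemma efficient_sum_factor: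
  assumes "n > 1"
  obtains (sum) a b where "0 < b" "b \<le> a" "n = a + b" "complexity n = complexity a + complexity b"
  | (prod) a b c where "0 < b" "b \<le> a" "complexity (a + b) = complexity a + complexity b"
      "c > 1" "n = (a + b) * c" "complexity n = complexity (a + b) + complexity c"
proof -
  have "(\<exists>a b. 0 < b \<and> b \<le> a \<and> n = a + b \<and> complexity n = complexity a + complexity b)
    \<or> (\<exists>a b c. 0 < b \<and> b \<le> a \<and> complexity (a + b) = complexity a + complexity b \<and>
        c > 1 \<and> n = (a + b) * c \<and> complexity n = complexity (a + b) + complexity c)"
    (is "?S n \<or> ?P n")
    using assms
  proof (induction n rule: less_induct)
    case (less n)
    from less.prems show ?case
    proof (cases rule: complexity_cases)
      case (sum a b)
      then show ?thesis by blast
    next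
      case (prod x y)
      then have "?S x \<or> ?P x" by (intro less.IH) auto
      then show ?thesis
      proof
        assume "?S x"
        then show ?thesis using prod by metis
      next
        assume "?P x"
        then obtain a b c where abc: "0 < b" "b \<le> a" "complexity (a + b) = complexity a + complexity b"
          "c > 1" "x = (a + b) * c" "complexity x = complexity (a + b) + complexity c" by blast
        have "n = (a + b) * (c * y)" using prod abc by (simp add: algebra_simps)
        \<comment> \<open>Regrouping keeps efficiency: \<parallel>n\<parallel> \<le> \<parallel>a +
          b\<parallel> + \<parallel>cy\<parallel> \<le> \<parallel>a + b\<parallel> +
          \<parallel>c\<parallel> + \<parallel>y\<parallel> = \<parallel>n\<parallel>, so equality
          holds throughout.\<close>
        moreover have "complexity n = complexity (a + b) + complexity (c * y)"
          using complexity_mult_le[of c y] complexity_mult_le[of "a + b" "c * y"] prod abc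
          by (simp add: calculation)
        moreover have "c * y > 1" using abc(4) prod(2) by (rule less_1_mult)
        ultimately show ?thesis using abc by blast
      qed
    qed
  qed
  then show thesis using that by metis
qed

subsection \<open>Sequences of bounded defect\<close>

text \<open>The limit \<open>C - 3 log\<^sub>3 m\<close> equals \<open>\<delta>(m) + j\<close> for \<open>j = C - \<parallel>m\<parallel>\<close>; writing it with \<open>C\<close> makes
  both the limit and the residue class additive under products.\<close>

definition convergent_defects :: "(nat \<Rightarrow> nat) \<Rightarrow> nat \<Rightarrow> nat \<Rightarrow> bool" where
  "convergent_defects n m C \<longleftrightarrow> m > 0 \<and> (\<lambda>i. defect (n i)) \<longlonglongrightarrow> real C - 3 * log 3 (real m) \<and>
    (\<forall>i. [complexity (n i) = C] (mod 3)) \<and>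
    (strict_mono (\<lambda>i. defect (n i)) \<and> C > complexity m \<or>
     (\<forall>i j. defect (n i) = defect (n j)) \<and> C \<ge> complexity m)"

text \<open>A form of sequential compactness that excludes decreasing defects and names the possible
  limits at the same time. Being stated with sequences, it passes through unions, products and sums
  by taking subsequences.\<close>

definition tame :: "nat set \<Rightarrow> bool" where
  "tame A \<longleftrightarrow> 0 \<notin> A \<and>
    (\<forall>n. range n \<subseteq> A \<longrightarrow> (\<exists>r :: nat \<Rightarrow> nat. \<exists>m C. strict_mono r \<and> convergent_defects (n \<circ> r) m C))"

lemma tameD:
  fixes n :: "nat \<Rightarrow> nat"
  assumes "tame A" "\<And>i. n i \<in> A"
  obtains r m C where "strict_mono r" "convergent_defects (n \<circ> r) m C"
proof -
  have "range n \<subseteq> A" using assms(2) by blast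
  moreover have "\<forall>n. range n \<subseteq> A \<longrightarrow> (\<exists>r :: nat \<Rightarrow> nat. \<exists>m C. strict_mono r \<and> convergent_defects (n \<circ> r) m C)"
    using assms(1) unfolding tame_def by (rule conjunct2)
  ultimately have "\<exists>r :: nat \<Rightarrow> nat. \<exists>m C. strict_mono r \<and> convergent_defects (n \<circ> r) m C"
    by (elim allE impE)
  then show thesis using that by (elim exE conjE)
qed

lemma tame_pos: "tame A \<Longrightarrow> x \<in> A \<Longrightarrow> x > 0"
  unfolding tame_def by (metis gr0I)

lemma convergent_defects_subseq:
  assumes "convergent_defects n m C" "strict_mono r"
  shows "convergent_defects (n \<circ> r) m C"
proof -
  have "(\<lambda>i. defect ((n \<circ> r) i)) \<longlonglongrightarrow> real C - 3 * log 3 (real m)"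
    using LIMSEQ_subseq_LIMSEQ[OF _ assms(2), of "\<lambda>i. defect (n i)"] assms(1)
    by (simp add: convergent_defects_def o_def)
  then show ?thesis
    using assms unfolding convergent_defects_def by (auto simp: strict_mono_def)
qed

lemma convergent_defects_const:
  "m > 0 \<Longrightarrow> convergent_defects (\<lambda>_. m) m (complexity m)"
  by (simp add: convergent_defects_def flip: defect_def)

text \<open>Serves to strip factors of 3, which change the complexity only by multiples of 3 and
  leave the defect alone.\<close>

lemma convergent_defects_transfer:
  assumes "convergent_defects b m C" "\<And>i. defect (n i) = defect (b i)"
    "\<And>i. [complexity (n i) = complexity (b i)] (mod 3)"
  shows "convergent_defects n m C"
  using assms unfolding convergent_defects_def by (auto intro: cong_trans)

section \<open>Closure of tame sets under finite unions, efficient products and addition of a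
  constant\<close>

lemma tame_empty: "tame {}"
  by (simp add: tame_def)

lemma tame_subset: "tame B \<Longrightarrow> A \<subseteq> B \<Longrightarrow> tame A"
  unfolding tame_def by blast

lemma tame_singleton:
  assumes "m > 0"
  shows "tame {m}"
  unfolding tame_def
proof (intro conjI allI impI)
  fix n :: "nat \<Rightarrow> nat" assume "range n \<subseteq> {m}"
  then have "n \<circ> (\<lambda>i. i) = (\<lambda>_. m)" by (auto simp: fun_eq_iff)
  then show "\<exists>r k C. strict_mono r \<and> convergent_defects (n \<circ> r) k C"
    using convergent_defects_const[OF assms] strict_mono_id
    by (intro exI[of _ "\<lambda>i. i"] exI conjI) (auto simp: id_def)
qed (use assms in auto)

lemma tame_Un:
  assumes "tame A" "tame B"
  shows "tame (A \<union> B)"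
  unfolding tame_def
proof (intro conjI allI impI)
  fix n :: "nat \<Rightarrow> nat" assume n: "range n \<subseteq> A \<union> B"
  have *: "\<exists>r :: nat \<Rightarrow> nat. \<exists>m C. strict_mono r \<and> convergent_defects (n \<circ> r) m C"
    if X: "tame X" "infinite {i. n i \<in> X}" for X
  proof -
    obtain r :: "nat \<Rightarrow> nat" where "strict_mono r" "\<forall>i. r i \<in> {i. n i \<in> X}"
      using infinite_enumerate[OF X(2)] by blast
    then have r: "strict_mono r" "\<And>i. (n \<circ> r) i \<in> X" by simp_all
    obtain s m C where "strict_mono s" "convergent_defects ((n \<circ> r) \<circ> s) m C"
      using tameD[OF X(1) r(2)] .
    then show ?thesis using strict_mono_o[OF r(1), of s] by (metis comp_assoc)
  qed
  have "UNIV = {i. n i \<in> A} \<union> {i. n i \<in> B}" using n by auto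
  then have "infinite {i. n i \<in> A} \<or> infinite {i. n i \<in> B}"
    by (metis finite_Un infinite_UNIV_nat)
  then show "\<exists>r m C. strict_mono r \<and> convergent_defects (n \<circ> r) m C" using * assms by blast
qed (use assms in \<open>auto simp: tame_def\<close>)

lemma tame_UN: "finite I \<Longrightarrow> (\<And>i. i \<in> I \<Longrightarrow> tame (A i)) \<Longrightarrow> tame (\<Union>i\<in>I. A i)"
  by (induction I rule: finite_induct) (auto intro: tame_empty tame_Un)

text \<open>Defects, limits and residues all add. One strictly increasing factor makes the product
  strictly increasing, and its strict inequality C > \<parallel>m\<parallel> survives because
  complexity is submultiplicative in the additive sense \<parallel>mm'\<parallel> \<le>
  \<parallel>m\<parallel> + \<parallel>m'\<parallel>.\<close>

lemma convergent_defects_mult: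
  assumes x: "convergent_defects x m C" and y: "convergent_defects y m' C'"
    and pos: "\<And>i. x i > 0" "\<And>i. y i > 0"
    and eff: "\<And>i. complexity (x i * y i) = complexity (x i) + complexity (y i)"
  shows "convergent_defects (\<lambda>i. x i * y i) (m * m') (C + C')"
proof -
  have m: "m > 0" "m' > 0" using x y by (auto simp: convergent_defects_def)
  have def: "defect (x i * y i) = defect (x i) + defect (y i)" for i
    using pos eff by (intro defect_mult) auto
  have "(\<lambda>i. defect (x i * y i)) \<longlonglongrightarrow> (real C - 3 * log 3 m) + (real C' - 3 * log 3 m')"
    unfolding def using x y by (intro tendsto_add) (auto simp: convergent_defects_def)
  moreover have "(real C - 3 * log 3 m) + (real C' - 3 * log 3 m') = real (C + C') - 3 * log 3 (real (m * m'))"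
    using m by (simp add: log_mult)
  moreover have "[complexity (x i * y i) = C + C'] (mod 3)" for i
    unfolding eff using x y by (intro cong_add) (auto simp: convergent_defects_def)
  moreover have "complexity (m * m') \<le> complexity m + complexity m'"
    using m by (rule complexity_mult_le)
  moreover have "strict_mono (\<lambda>i. defect (x i * y i)) \<and> C + C' > complexity m + complexity m' \<or>
     (\<forall>i j. defect (x i * y i) = defect (x j * y j)) \<and> C + C' \<ge> complexity m + complexity m'"
  proof -
    consider "strict_mono (\<lambda>i. defect (x i))" "C > complexity m" "strict_mono (\<lambda>i. defect (y i))" "C' > complexity m'"
      | "strict_mono (\<lambda>i. defect (x i))" "C > complexity m" "\<And>i j. defect (y i) = defect (y j)" "C' \<ge> complexity m'"
      | "\<And>i j. defect (x i) = defect (x j)" "C \<ge> complexity m" "strict_mono (\<lambda>i. defect (y i))" "C' > complexity m'"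
      | "\<And>i j. defect (x i) = defect (x j)" "C \<ge> complexity m" "\<And>i j. defect (y i) = defect (y j)" "C' \<ge> complexity m'"
      using x y unfolding convergent_defects_def by metis
    then show ?thesis
    proof cases
      case 1
      then have "strict_mono (\<lambda>i. defect (x i * y i))"
        unfolding def strict_mono_def by (simp add: add_strict_mono)
      then show ?thesis using 1(2,4) by simp
    next
      case 2
      have "strict_mono (\<lambda>i. defect (x i * y i))"
        unfolding def using strict_monoD[OF 2(1)] 2(3) by (intro strict_monoI add_less_le_mono) (auto intro: order_eq_refl)
      then show ?thesis using 2(2,4) by simp
    next
      case 3
      have "strict_mono (\<lambda>i. defect (x i * y i))"
        unfolding def using strict_monoD[OF 3(3)] 3(1) by (intro strict_monoI add_le_less_mono) (auto intro: order_eq_refl)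
      then show ?thesis using 3(2,4) by simp
    next
      case 4
      have "defect (x i * y i) = defect (x j * y j)" for i j
        by (simp only: def 4(1)[of i j] 4(3)[of i j])
      then show ?thesis using 4(2,4) by auto
    qed
  qed
  ultimately show ?thesis
    using m unfolding convergent_defects_def by auto
qed

lemma tame_mult:
  assumes "tame A" "tame B"
  shows "tame {x * y | x y. x \<in> A \<and> y \<in> B \<and> complexity (x * y) = complexity x + complexity y}"
    (is "tame ?M")
  unfolding tame_def
proof (intro conjI allI impI)
  show "0 \<notin> ?M" using tame_pos[OF assms(1)] tame_pos[OF assms(2)] by fastforce
  fix n :: "nat \<Rightarrow> nat" assume "range n \<subseteq> ?M"
  then have "\<forall>i. \<exists>x y. x \<in> A \<and> y \<in> B \<and> n i = x * y \<and> complexity (x * y) = complexity x + complexity y"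
    by fast
  then obtain x y where xy: "\<And>i. x i \<in> A" "\<And>i. y i \<in> B" "\<And>i. n i = x i * y i"
    "\<And>i. complexity (x i * y i) = complexity (x i) + complexity (y i)" by metis
  obtain r m C where r: "strict_mono r" "convergent_defects (x \<circ> r) m C"
    using tameD[OF assms(1) xy(1)] .
  have "(y \<circ> r) i \<in> B" for i using xy(2) by simp
  then obtain s m' C' where s: "strict_mono s" "convergent_defects ((y \<circ> r) \<circ> s) m' C'"
    using tameD[OF assms(2)] by blast
  have nz: "x i > 0" "y i > 0" for i
    using xy(1,2)[of i] assms tame_pos by auto
  have "convergent_defects (\<lambda>i. ((x \<circ> r) \<circ> s) i * ((y \<circ> r) \<circ> s) i) (m * m') (C + C')"
    using convergent_defects_subseq[OF r(2) s(1)] s(2) by (rule convergent_defects_mult) (simp_all add: nz xy(4))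
  moreover have "(\<lambda>i. ((x \<circ> r) \<circ> s) i * ((y \<circ> r) \<circ> s) i) = n \<circ> (r \<circ> s)"
    by (auto simp: xy(3))
  ultimately show "\<exists>r m C. strict_mono r \<and> convergent_defects (n \<circ> r) m C"
    using strict_mono_o[OF r(1) s(1)] by metis
qed

lemma nat_seq_const_or_strict_mono_subseq:
  fixes f :: "nat \<Rightarrow> nat"
  obtains r :: "nat \<Rightarrow> nat" and c where "strict_mono r" "\<And>i. f (r i) = c"
  | r :: "nat \<Rightarrow> nat" where "strict_mono r" "strict_mono (\<lambda>i. f (r i))"
proof (cases "\<exists>c. infinite {i. f i = c}")
  case True
  then obtain c where "infinite {i. f i = c}" by blast
  from infinite_enumerate[OF this] obtain r :: "nat \<Rightarrow> nat" where "strict_mono r" "\<forall>i. r i \<in> {i. f i = c}" by blast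
  then have "strict_mono r" "\<And>i. f (r i) = c" by simp_all
  then show thesis by (rule that(1))
next
  case False
  have "\<exists>y>x. f y > f x" for x
  proof -
    have "{i. f i \<le> f x} = (\<Union>c\<le>f x. {i. f i = c})" by auto
    then have "finite {i. f i \<le> f x}" using False by simp
    then have "finite ({i. f i \<le> f x} \<union> {..x})" by simp
    then obtain y where "y \<notin> {i. f i \<le> f x} \<union> {..x}"
      using ex_new_if_finite infinite_UNIV_nat by blast
    then show ?thesis by (intro exI[of _ y]) auto
  qed
  then have "\<exists>r. \<forall>i. r i < r (Suc i) \<and> f (r i) < f (r (Suc i))"
    using dependent_nat_choice[of "\<lambda>_ _. True" "\<lambda>_ x y. x < y \<and> f x < f y"] by blast
  then show thesis using that(2) by (auto simp: strict_mono_Suc_iff)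
qed

text \<open>As c tends to infinity, 3 log_3(1 + d/c) decreases strictly to 0. So the defects of c +
  d increase strictly, even when those of c are constant, and their limit exceeds the limit for c by
  \<parallel>d\<parallel>; the number m stays the same.\<close>

lemma convergent_defects_add:
  assumes c: "convergent_defects c m C" and mono: "strict_mono c"
    and pos: "\<And>i. c i > 0" and d: "d > 0"
    and eff: "\<And>i. complexity (c i + d) = complexity (c i) + complexity d"
  shows "convergent_defects (\<lambda>i. c i + d) m (C + complexity d)"
proof -
  define t where "t i = real (complexity d) - 3 * log 3 (1 + d / c i)" for i
  have def: "defect (c i + d) = defect (c i) + t i" for i
    unfolding t_def using pos eff by (intro defect_add) auto
  have "filterlim (\<lambda>i. real (c i)) at_top sequentially"
    using filterlim_compose[OF filterlim_real_sequentially filterlim_subseq[OF mono]] by simp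
  then have "(\<lambda>i. real d / real (c i)) \<longlonglongrightarrow> 0"
    by (rule real_tendsto_divide_at_top[OF tendsto_const])
  then have "(\<lambda>i. log 3 (1 + d / c i)) \<longlonglongrightarrow> log 3 (1 + 0)"
    by (intro tendsto_log tendsto_add tendsto_const) auto
  then have "t \<longlonglongrightarrow> real (complexity d) - 3 * log 3 (1 + 0)"
    unfolding t_def by (intro tendsto_diff tendsto_mult tendsto_const) auto
  then have "(\<lambda>i. defect (c i) + t i) \<longlonglongrightarrow> (real C - 3 * log 3 (real m)) + (real (complexity d) - 3 * log 3 (1 + 0))"
    using c by (intro tendsto_add) (auto simp: convergent_defects_def)
  then have "(\<lambda>i. defect (c i + d)) \<longlonglongrightarrow> real (C + complexity d) - 3 * log 3 (real m)"
    by (simp add: def add_diff_eq diff_add_eq)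
  moreover have "[complexity (c i + d) = C + complexity d] (mod 3)" for i
    unfolding eff using c by (intro cong_add) (auto simp: convergent_defects_def)
  moreover have "strict_mono (\<lambda>i. defect (c i + d))"
  proof (rule strict_monoI)
    fix i j :: nat assume ij: "i < j"
    have "defect (c i) \<le> defect (c j)"
      using c ij unfolding convergent_defects_def strict_mono_def by (metis order_less_imp_le order_refl)
    moreover have "real d / c j < real d / c i"
      using pos[of i] d strict_monoD[OF mono ij] by (intro divide_strict_left_mono) auto
    then have "log 3 (1 + d / c j) < log 3 (1 + d / c i)"
      by (subst log_less_cancel_iff) (auto simp: add_pos_nonneg)
    then have "t i < t j" by (simp add: t_def)
    ultimately show "defect (c i + d) < defect (c j + d)" by (simp add: def)
  qed
  moreover have "C + complexity d > complexity m"
    using c complexity_pos[OF d] by (auto simp: convergent_defects_def)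
  ultimately show ?thesis using c by (auto simp: convergent_defects_def)
qed

lemma tame_add:
  assumes "tame A" "d > 0"
  shows "tame {c + d | c. c \<in> A \<and> complexity (c + d) = complexity c + complexity d}"
    (is "tame ?M")
  unfolding tame_def
proof (intro conjI allI impI)
  show "0 \<notin> ?M" using assms(2) by auto
  fix n :: "nat \<Rightarrow> nat" assume "range n \<subseteq> ?M"
  then have "\<forall>i. \<exists>c. c \<in> A \<and> n i = c + d \<and> complexity (c + d) = complexity c + complexity d"
    by fast
  then obtain c where c: "\<And>i. c i \<in> A" "\<And>i. n i = c i + d"
    "\<And>i. complexity (c i + d) = complexity (c i) + complexity d" by metis
  obtain r m C where r: "strict_mono r" "convergent_defects (c \<circ> r) m C"
    using tameD[OF assms(1) c(1)] .
  have nz: "c i > 0" for i using c(1)[of i] assms(1) tame_pos by auto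
  show "\<exists>r m C. strict_mono r \<and> convergent_defects (n \<circ> r) m C"
  proof (rule nat_seq_const_or_strict_mono_subseq[of "c \<circ> r"])
    fix s :: "nat \<Rightarrow> nat" and k assume s: "strict_mono s" "\<And>i. (c \<circ> r) (s i) = k"
    then have "n \<circ> (r \<circ> s) = (\<lambda>_. k + d)" by (auto simp: c(2))
    then have "convergent_defects (n \<circ> (r \<circ> s)) (k + d) (complexity (k + d))"
      using convergent_defects_const[of "k + d"] assms(2) by simp
    then show ?thesis using strict_mono_o[OF r(1) s(1)] by blast
  next
    fix s :: "nat \<Rightarrow> nat" assume s: "strict_mono s" "strict_mono (\<lambda>i. (c \<circ> r) (s i))"
    have "convergent_defects (\<lambda>i. ((c \<circ> r) \<circ> s) i + d) m (C + complexity d)"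
      using convergent_defects_subseq[OF r(2) s(1)]
      by (rule convergent_defects_add) (use s nz assms(2) c(3) in \<open>simp_all add: o_def\<close>)
    moreover have "(\<lambda>i. ((c \<circ> r) \<circ> s) i + d) = n \<circ> (r \<circ> s)" by (auto simp: c(2))
    ultimately have "convergent_defects (n \<circ> (r \<circ> s)) m (C + complexity d)" by simp
    then show ?thesis using strict_mono_o[OF r(1) s(1)] by blast
  qed
qed

text \<open>Up to factors of 3, a number with defect below (N + 1)\<delta>(2) is one of finitely
  many small numbers, an efficient sum c + d with c in the previous set and d from a finite set, or
  an efficient product of such a number with a member of the previous set. All these families are
  tame by the closure properties.\<close>

lemma tame_defect_less_step:
  assumes "tame {n. n > 0 \<and> defect n < real N * defect 2}" (is "tame ?A")
  shows "tame {n. n > 0 \<and> defect n < real (Suc N) * defect 2}" (is "tame ?A'")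
proof -
  \<comment> \<open>The bound N + 3 is (N + 1) + 2: the defect of the sum is below (N +
    1)\<delta>(2) < N + 1, and the complexity of d is at most that defect plus 2.\<close>
  define D where "D = {d. d > 0 \<and> complexity d \<le> N + 3}"
  define U where "U = {1} \<union> {2} \<union> {3} \<union>
    (\<Union>d\<in>D. {c + d | c. c \<in> ?A \<and> complexity (c + d) = complexity c + complexity d})"
  define B where "B = U \<union> {x * y | x y. x \<in> U \<and> y \<in> ?A \<and> complexity (x * y) = complexity x + complexity y}"
  have U: "tame U" unfolding U_def D_def
    by (intro tame_Un tame_UN tame_add tame_singleton finite_complexity_le assms) auto
  then have B: "tame B" unfolding B_def using assms by (intro tame_Un tame_mult)
  have sum_in_U: "a + b \<in> U"
    if ab: "0 < b" "b \<le> a" "complexity (a + b) = complexity a + complexity b"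
      "defect (a + b) < real (Suc N) * defect 2" for a b
  proof (cases "a + b > 3")
    case True
    note sum = defect_efficient_sum[OF ab(1,2) True ab(3)]
    have "defect a < real N * defect 2" using sum(1) ab(4) by (simp add: algebra_simps)
    have "real (Suc N) * defect 2 \<le> real (Suc N) * 1"
      using two_defect_2_less_1 defect_2_pos by (intro mult_left_mono) auto
    moreover have "0 \<le> defect a" by (rule defect_nonneg) (use ab in simp)
    ultimately have "real (complexity b) \<le> real (Suc N) * 1 + 2"
      using sum(3) ab(4) by linarith
    then have "complexity b \<le> N + 3" by simp
    then show ?thesis using ab \<open>defect a < _\<close> by (auto simp: U_def D_def)
  next
    case False
    then have "a + b = 2 \<or> a + b = 3" using ab by linarith
    then show ?thesis by (auto simp: U_def)
  qed
  \<comment> \<open>Factors of \<open>3\<close> are split off because they are the only efficient sums that do not lower the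
    defect of the cofactor; they change neither the defect nor the residue class.\<close>
  have red: "\<exists>b\<in>B. defect n = defect b \<and> [complexity n = complexity b] (mod 3)" if "n \<in> ?A'" for n
    using that
  proof (induction n rule: less_induct)
    case (less n)
    then have n: "n > 0" "defect n < real (Suc N) * defect 2" by auto
    show ?case
    proof (cases "n > 1")
      case False
      then have "n = 1" using n by simp
      then show ?thesis by (auto simp: B_def U_def)
    next
      case True
      then show ?thesis
      proof (cases rule: efficient_sum_factor)
        case (sum a b)
        then have "n \<in> U" using sum_in_U n by metis
        then show ?thesis by (auto simp: B_def)
      next
        case (prod a b c)
        have def: "defect n = defect (a + b) + defect c"
          using prod by (auto intro: defect_mult)
        show ?thesis
        proof (cases "a + b = 3")
          case True
          then have "c \<in> ?A'" "c < n" using prod n def by auto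
          then obtain x where "x \<in> B" "defect c = defect x" "[complexity c = complexity x] (mod 3)"
            using less.IH by blast
          moreover have "[complexity n = complexity c] (mod 3)"
            unfolding prod(6) True by (simp add: Cong.cong_def)
          ultimately show ?thesis using def True cong_trans by fastforce
        next
          case False
          \<comment> \<open>An efficient sum other than 3 uses up at least \<delta>(2) of the
            defect, which moves the cofactor c into the previous set.\<close>
          have "defect 2 \<le> defect (a + b)"
          proof (cases "a + b = 2")
            case False
            then have "a + b > 3" using \<open>a + b \<noteq> 3\<close> prod by linarith
            then show ?thesis using defect_efficient_sum(1)[of b a] prod defect_nonneg[of a] by simp
          qed simp
          then have "c \<in> ?A" using prod n def by (simp add: algebra_simps)
          moreover have "a + b \<in> U"
            using prod n def defect_nonneg[of c] by (intro sum_in_U) auto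
          ultimately have "n \<in> B" using prod unfolding B_def by blast
          then show ?thesis by (intro bexI[of _ n]) auto
        qed
      qed
    qed
  qed
  show ?thesis
    unfolding tame_def
  proof (intro conjI allI impI)
    fix n :: "nat \<Rightarrow> nat" assume "range n \<subseteq> ?A'"
    then have "\<forall>i. \<exists>b\<in>B. defect (n i) = defect b \<and> [complexity (n i) = complexity b] (mod 3)"
      using red by (simp add: image_subset_iff)
    then obtain b where b: "\<And>i. b i \<in> B" "\<And>i. defect (n i) = defect (b i)"
      "\<And>i. [complexity (n i) = complexity (b i)] (mod 3)" by metis
    obtain r m C where r: "strict_mono r" "convergent_defects (b \<circ> r) m C"
      using tameD[OF B b(1)] .
    have "convergent_defects (n \<circ> r) m C"
      using r(2) b by (intro convergent_defects_transfer[OF r(2)]) auto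
    then show "\<exists>r m C. strict_mono r \<and> convergent_defects (n \<circ> r) m C" using r(1) by blast
  qed auto
qed

lemma tame_defect_le: "tame {n. n > 0 \<and> defect n \<le> B}"
proof -
  have "tame {n. n > 0 \<and> defect n < real N * defect 2}" for N
  proof (induction N)
    case 0
    have "\<not> defect n < 0" if "n > 0" for n using defect_nonneg[OF that] by simp
    then have "{n. n > 0 \<and> defect n < real 0 * defect 2} = {}" by auto
    then show ?case by (simp only: tame_empty)
  qed (rule tame_defect_less_step)
  moreover obtain N where "B < real N * defect 2"
    using defect_2_pos ex_less_of_nat_mult by blast
  then have "{n. n > 0 \<and> defect n \<le> B} \<subseteq> {n. n > 0 \<and> defect n < real N * defect 2}" by auto
  ultimately show ?thesis by (rule tame_subset)
qed

subsection \<open>Iterated derived sets and order types\<close>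

definition derived :: "real set \<Rightarrow> real set" where
  "derived S = {x. x islimpt S}"

text \<open>For sets bounded below this is equivalent to being well-ordered, since a strictly
  decreasing sequence would converge to a limit from the right.\<close>

definition no_right_limits :: "real set \<Rightarrow> bool" where
  "no_right_limits S \<longleftrightarrow> (\<forall>x. \<not> x islimpt (S \<inter> {x<..}))"

lemma mem_derived: "x \<in> derived S \<longleftrightarrow> x islimpt S"
  by (simp add: derived_def)

lemma derived_pow_Un: "(derived ^^ k) (S \<union> T) = (derived ^^ k) S \<union> (derived ^^ k) T"
  by (induction k) (auto simp: mem_derived islimpt_Un)

lemma derived_pow_mono: "S \<subseteq> T \<Longrightarrow> (derived ^^ k) S \<subseteq> (derived ^^ k) T"
  by (metis derived_pow_Un sup.absorb_iff2)

lemma derived_pow_subset_closed: "closed T \<Longrightarrow> S \<subseteq> T \<Longrightarrow> (derived ^^ k) S \<subseteq> T"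
proof (induction k)
  case (Suc k)
  show ?case
  proof
    fix x assume "x \<in> (derived ^^ Suc k) S"
    then have "x islimpt T" using islimpt_subset[OF _ Suc.IH[OF Suc.prems]] by (simp add: mem_derived)
    then show "x \<in> T" using Suc.prems(1) closed_limpt by blast
  qed
qed simp

lemma no_right_limits_subset: "no_right_limits T \<Longrightarrow> S \<subseteq> T \<Longrightarrow> no_right_limits S"
  unfolding no_right_limits_def by (meson Int_mono islimpt_subset order_refl)

text \<open>There is a gap (p, p + e) above p, so S without p lies in the closed ray from p + e on.
  The first derived set already forgets the isolated point p, and all later ones stay in the
  ray.\<close>

lemma not_in_derived_pow_atLeast:
  assumes "no_right_limits S" "S \<subseteq> {p..}" "k > 0"
  shows "p \<notin> (derived ^^ k) S"
proof -
  obtain e where e: "e > 0" "\<And>x. x \<in> S \<Longrightarrow> x > p \<Longrightarrow> \<not> x < p + e"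
  proof -
    have "\<not> p islimpt (S \<inter> {p<..})" using assms(1) by (simp add: no_right_limits_def)
    then obtain e where e: "e > 0" "\<And>x. x \<in> S \<inter> {p<..} \<Longrightarrow> x \<noteq> p \<Longrightarrow> \<not> dist x p < e"
      unfolding islimpt_approachable by blast
    show thesis by (rule that[OF e(1)]) (use e(2) in \<open>force simp: dist_real_def\<close>)
  qed
  obtain j where k: "k = Suc j" using assms(3) gr0_conv_Suc by blast
  have "S \<subseteq> {p} \<union> {p + e..}" using e(2) assms(2) by force
  then have "derived S \<subseteq> derived ({p} \<union> {p + e..})"
    using derived_pow_mono[of _ _ 1] by simp
  also have "\<dots> \<subseteq> {p + e..}"
    using closed_limpt[of "{p + e..}"] by (auto simp: mem_derived islimpt_insert)
  finally have "(derived ^^ j) (derived S) \<subseteq> {p + e..}"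
    by (intro derived_pow_subset_closed) auto
  then show ?thesis using e(1) unfolding k by (auto simp: funpow_swap1)
qed

lemma derived_pow_translate:
  "x \<in> (derived ^^ k) S \<Longrightarrow> x + t \<in> (derived ^^ k) ((\<lambda>x. x + t) ` S)"
proof (induction k arbitrary: x)
  case (Suc k)
  then have "x islimpt (derived ^^ k) S" by (simp add: mem_derived)
  then have "x + t islimpt (\<lambda>x. x + t) ` (derived ^^ k) S"
    unfolding islimpt_approachable by (force simp: dist_real_def)
  then have "x + t islimpt (derived ^^ k) ((\<lambda>x. x + t) ` S)"
    by (rule islimpt_subset) (use Suc.IH in blast)
  then show ?case by (simp add: mem_derived)
qed auto

section \<open>From derived sets to order types\<close>

lemma card_less_strict_mono:
  fixes P :: "'a::linorder set"
  assumes "finite {q \<in> P. q < y}" "x \<in> P" "x < y"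
  shows "card {q \<in> P. q < x} < card {q \<in> P. q < y}"
proof (rule psubset_card_mono[OF assms(1)])
  have "x \<in> {q \<in> P. q < y}" "x \<notin> {q \<in> P. q < x}" using assms by simp_all
  moreover have "{q \<in> P. q < x} \<subseteq> {q \<in> P. q < y}" using assms(3) by fastforce
  ultimately show "{q \<in> P. q < x} \<subset> {q \<in> P. q < y}" by blast
qed

lemma bij_betw_card_less:
  fixes P :: "real set"
  assumes "infinite P" "\<And>p. p \<in> P \<Longrightarrow> finite {q \<in> P. q < p}"
  shows "bij_betw (\<lambda>p. card {q \<in> P. q < p}) P UNIV"
proof -
  let ?h = "\<lambda>p. card {q \<in> P. q < p}"
  have mono: "?h p < ?h q" if "p \<in> P" "q \<in> P" "p < q" for p q
    by (intro card_less_strict_mono assms(2) that)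
  have inj: "inj_on ?h P"
  proof (rule inj_onI)
    fix p q assume "p \<in> P" "q \<in> P" "?h p = ?h q"
    then show "p = q" using mono[of p q] mono[of q p] by (cases p q rule: linorder_cases) auto
  qed
  have "i \<in> ?h ` P" for i
  proof -
    have "infinite (?h ` P)" using inj assms(1) finite_imageD by blast
    then obtain p where p: "p \<in> P" "?h p > i"
      unfolding infinite_nat_iff_unbounded by blast
    have "?h ` {q \<in> P. q < p} \<subseteq> {..<?h p}" using mono p(1) by auto
    moreover have "card (?h ` {q \<in> P. q < p}) = ?h p"
      by (rule card_image) (use inj in \<open>auto simp: inj_on_def\<close>)
    \<comment> \<open>The counts of the elements below p are as many distinct numbers below
      \<open>?h p\<close> as there are numbers below it, so none is skipped.\<close>
    ultimately have "?h ` {q \<in> P. q < p} = {..<?h p}"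
      by (intro card_subset_eq) auto
    then have "i \<in> ?h ` {q \<in> P. q < p}" using p(2) by simp
    then show ?thesis by blast
  qed
  then show ?thesis using inj by (auto simp: bij_betw_def)
qed

lemma finite_below_limit:
  fixes P :: "real set"
  assumes "P \<subseteq> {b..}" "derived P \<subseteq> {L}" "x < L"
  shows "finite {q \<in> P. q \<le> x}"
proof (rule ccontr)
  assume inf: "infinite {q \<in> P. q \<le> x}"
  have "{q \<in> P. q \<le> x} \<subseteq> {b..x}" using assms(1) by auto
  then obtain y where "y \<in> {b..x}" "y islimpt {q \<in> P. q \<le> x}"
    using inf compact_eq_Bolzano_Weierstrass[THEN iffD1, rule_format, OF compact_Icc] by blast
  then have "y \<in> derived P" "y \<le> x" unfolding mem_derived by (auto elim: islimpt_subset)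
  then show False using assms(2,3) by auto
qed

lemma infinite_below_limit:
  fixes P :: "real set"
  assumes "L islimpt P" "P \<subseteq> {..L}"
  shows "infinite (P \<inter> {..<L})"
proof -
  have "P \<subseteq> insert L (P \<inter> {..<L})" using assms(2) by force
  then have "L islimpt insert L (P \<inter> {..<L})" using assms(1) islimpt_subset by blast
  then have "L islimpt (P \<inter> {..<L})" by (simp add: islimpt_insert)
  then show ?thesis using islimpt_finite by blast
qed

text \<open>The induction follows \<omega>^(k+1) = \<omega>^k \<cdot> \<omega>: the points below L
  in the next lower derived set have type \<omega> and cut S into \<omega> consecutive pieces of
  type \<omega>^k. It starts at exponent 1, since a derived set of order 0 equal to {L} would be S
  itself, which lies below L.\<close>

lemma omega_pow_embedding:
  fixes S :: "real set"
  assumes "S \<subseteq> {b..<L}" "no_right_limits S" "(derived ^^ Suc k) S = {L}"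
  shows "\<exists>f. bij_betw f S {xs. length xs = Suc k} \<and>
    (\<forall>x\<in>S. \<forall>y\<in>S. x < y \<longrightarrow> (f x, f y) \<in> omega_pow (Suc k))"
  using assms
proof (induction k arbitrary: S b L)
  case 0
  have fin: "finite {q \<in> S. q < p}" if "p \<in> S" for p
    by (rule finite_subset[OF _ finite_below_limit[of S b L p]]) (use 0 that in auto)
  have S: "S \<inter> {..<L} = S" using 0(1) by auto
  have "infinite S"
  proof -
    have "L islimpt S" using 0(3) by (simp flip: mem_derived)
    moreover have "S \<subseteq> {..L}" using 0(1) by auto
    ultimately show ?thesis using infinite_below_limit[of L S] S by simp
  qed
  then have "bij_betw (\<lambda>p. card {q \<in> S. q < p}) S UNIV"
    using fin by (rule bij_betw_card_less)
  moreover have "bij_betw (\<lambda>n. [n]) UNIV {xs :: nat list. length xs = Suc 0}"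
    by (auto simp: bij_betw_def inj_on_def length_Suc_conv)
  ultimately have "bij_betw ((\<lambda>n. [n]) \<circ> (\<lambda>p. card {q \<in> S. q < p})) S {xs. length xs = Suc 0}"
    by (rule bij_betw_trans)
  moreover have "card {q \<in> S. q < x} < card {q \<in> S. q < y}" if "x \<in> S" "y \<in> S" "x < y" for x y
    by (intro card_less_strict_mono fin that)
  ultimately show ?case
    by (intro exI[of _ "(\<lambda>n. [n]) \<circ> (\<lambda>p. card {q \<in> S. q < p})"]) (auto simp: Field_omega_pow comp_def)
next
  case (Suc k)
  define P where "P = (derived ^^ Suc k) S \<inter> {..<L}"
  have bound: "(derived ^^ j) S \<subseteq> {b..L}" for j
    using Suc.prems(1) by (intro derived_pow_subset_closed) auto
  have der: "derived ((derived ^^ Suc k) S) = {L}" using Suc.prems(3) by simp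
  have finle: "finite {q \<in> P. q \<le> x}" if "x < L" for x
    by (rule finite_subset[OF _ finite_below_limit[OF _ _ that, of "(derived ^^ Suc k) S" b]])
      (use bound[of "Suc k"] der in \<open>auto simp: P_def\<close>)
  have fin: "finite {q \<in> P. q < p}" if "p \<in> P" for p
    by (rule finite_subset[OF _ finle[of p]]) (use that in \<open>auto simp: P_def\<close>)
  have "infinite P"
    unfolding P_def
    using bound[of "Suc k"] der by (intro infinite_below_limit) (auto simp: mem_derived)
  from bij_betw_card_less[OF this fin]
  have bij: "bij_betw (\<lambda>p. card {q \<in> P. q < p}) P UNIV" .
  \<comment> \<open>Counting with \<le> puts a point of S that is itself a cut point into the piece
    starting there, so each piece lies strictly below its right end.\<close>
  define g where "g s = card {q \<in> P. q \<le> s}" for s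
  define piece where "piece i = {s \<in> S. g s = i}" for i
  have g_mono: "g s \<le> g t" if "s \<le> t" "t \<in> S" for s t
    unfolding g_def using that Suc.prems(1) by (intro card_mono finle) auto
  \<comment> \<open>The points of \<open>P\<close> cut \<open>S\<close> into consecutive pieces, each accumulating to order \<open>Suc k\<close> only at
    its right end.\<close>
  have "\<exists>f. bij_betw f (piece i) {xs. length xs = Suc k} \<and>
    (\<forall>x\<in>piece i. \<forall>y\<in>piece i. x < y \<longrightarrow> (f x, f y) \<in> omega_pow (Suc k))" for i
  proof -
    obtain p where p: "p \<in> P" "card {q \<in> P. q < p} = i"
      using bij_betw_imp_surj_on[OF bij] by (metis (no_types, lifting) UNIV_I imageE)
    define Q where "Q = {q \<in> P. q < p}"
    have Q: "finite Q" "card Q = i" using fin p by (auto simp: Q_def)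
    have below: "s < p" if "s \<in> piece i" for s
    proof (rule ccontr)
      assume "\<not> s < p"
      then have "insert p Q \<subseteq> {q \<in> P. q \<le> s}" using p(1) by (auto simp: Q_def)
      then have "card (insert p Q) \<le> g s"
        unfolding g_def using that Suc.prems(1) by (intro card_mono finle) (auto simp: piece_def)
      then show False using that Q by (simp add: piece_def Q_def)
    qed
    have above: "q \<le> s" if "s \<in> piece i" "q \<in> Q" for s q
    proof (rule ccontr)
      assume "\<not> q \<le> s"
      then have "{q \<in> P. q \<le> s} \<subset> Q" using that(2) by (auto simp: Q_def)
      then have "g s < i" unfolding g_def using Q psubset_card_mono by metis
      then show False using that(1) by (simp add: piece_def)
    qed
    have rest: "\<exists>q\<in>Q. s < q" if "s \<in> S" "s < p" "s \<notin> piece i" for s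
    proof (rule ccontr)
      assume "\<not> (\<exists>q\<in>Q. s < q)"
      then have "{q \<in> P. q \<le> s} = Q" using that(2) by (force simp: Q_def)
      then show False using that Q(2) by (simp add: piece_def g_def)
    qed
    have sub: "piece i \<subseteq> S" by (auto simp: piece_def)
    have nrl: "no_right_limits (piece i)"
      using Suc.prems(2) sub by (rule no_right_limits_subset)
    have p_der: "p \<in> (derived ^^ Suc k) S" "p < L" using p(1) by (auto simp: P_def)
    \<comment> \<open>The rest of S lies at or above p, where limits from the right are excluded, or
      below the largest earlier cut point, hence away from p. Neither part can contribute p to the
      derived set.\<close>
    have "p \<in> (derived ^^ Suc k) (piece i)"
    proof (rule ccontr)
      assume "p \<notin> (derived ^^ Suc k) (piece i)"
      moreover have "p \<notin> (derived ^^ Suc k) (S \<inter> {p..})"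
        by (rule not_in_derived_pow_atLeast) (use Suc.prems(2) no_right_limits_subset in auto)
      moreover have "p \<notin> (derived ^^ Suc k) (S \<inter> {..<p} - piece i)"
      proof (cases "Q = {}")
        case True
        then have empty: "S \<inter> {..<p} - piece i = {}" using rest by auto
        show ?thesis unfolding empty using derived_pow_subset_closed[of "{}" "{}" "Suc k"] by auto
      next
        case False
        have "s \<le> Max Q" if "s \<in> S \<inter> {..<p} - piece i" for s
        proof -
          have "s \<in> S" "s < p" "s \<notin> piece i" using that by simp_all
          then obtain q where "q \<in> Q" "s < q" using rest by blast
          then show ?thesis using Max_ge[OF Q(1), of q] by linarith
        qed
        then have "(derived ^^ Suc k) (S \<inter> {..<p} - piece i) \<subseteq> {..Max Q}"
          by (intro derived_pow_subset_closed) auto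
        moreover have "Max Q < p" using False Q(1) Max_in[of Q] by (auto simp: Q_def)
        ultimately show ?thesis by auto
      qed
      moreover have "S \<subseteq> piece i \<union> (S \<inter> {p..}) \<union> (S \<inter> {..<p} - piece i)" by auto
      then have "p \<in> (derived ^^ Suc k) (piece i \<union> (S \<inter> {p..}) \<union> (S \<inter> {..<p} - piece i))"
        using p_der(1) derived_pow_mono by blast
      ultimately show False unfolding derived_pow_Un by blast
    qed
    \<comment> \<open>Any other such x would be an earlier cut point. The whole piece lies at or
      above it, so it could only be a limit from the right.\<close>
    moreover have "x = p" if x: "x \<in> (derived ^^ Suc k) (piece i)" for x
    proof -
      have "(derived ^^ Suc k) (piece i) \<subseteq> {..p}"
        using below by (intro derived_pow_subset_closed) force+
      then have "x \<le> p" using x by auto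
      moreover have "x \<in> P"
        using x \<open>x \<le> p\<close> p_der(2) derived_pow_mono[OF sub, of "Suc k"] by (auto simp: P_def)
      moreover have "x \<notin> Q"
        using not_in_derived_pow_atLeast[OF nrl, of x "Suc k"] above x by (auto simp del: funpow.simps)
      ultimately show ?thesis by (auto simp: Q_def)
    qed
    ultimately have "(derived ^^ Suc k) (piece i) = {p}" by blast
    moreover have "piece i \<subseteq> {b..<p}" using below sub Suc.prems(1) by auto
    ultimately show ?thesis using nrl by (intro Suc.IH)
  qed
  then obtain F where F: "\<And>i. bij_betw (F i) (piece i) {xs. length xs = Suc k}"
    "\<And>i x y. x \<in> piece i \<Longrightarrow> y \<in> piece i \<Longrightarrow> x < y \<Longrightarrow> (F i x, F i y) \<in> omega_pow (Suc k)"
    by metis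
  define f where "f s = g s # F (g s) s" for s
  have in_piece: "s \<in> piece (g s)" if "s \<in> S" for s using that by (simp add: piece_def)
  have len: "length (F (g s) s) = Suc k" if "s \<in> S" for s
    using bij_betwE[OF F(1)[of "g s"]] in_piece[OF that] by auto
  have "inj_on f S"
  proof (rule inj_onI)
    fix x y assume xy: "x \<in> S" "y \<in> S" "f x = f y"
    then have "g x # F (g x) x = g y # F (g y) y" by (simp only: f_def)
    then have "g x = g y \<and> F (g x) x = F (g y) y" unfolding list.inject .
    then show "x = y"
      using inj_onD[OF bij_betw_imp_inj_on[OF F(1)[of "g x"]], of x y] in_piece xy(1,2) by metis
  qed
  moreover have "f ` S = {xs. length xs = Suc (Suc k)}"
  proof (intro equalityI subsetI)
    fix xs assume "xs \<in> {xs :: nat list. length xs = Suc (Suc k)}"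
    then obtain i ys where xs: "xs = i # ys" "length ys = Suc k" by (auto simp: length_Suc_conv)
    then obtain s where "s \<in> piece i" "F i s = ys"
      using bij_betw_imp_surj_on[OF F(1)[of i]] by (metis (mono_tags, lifting) imageE mem_Collect_eq)
    then show "xs \<in> f ` S" using xs(1) by (auto simp: f_def piece_def image_iff)
  qed (use len in \<open>auto simp: f_def\<close>)
  moreover have "(f x, f y) \<in> omega_pow (Suc (Suc k))" if "x \<in> S" "y \<in> S" "x < y" for x y
  proof (cases "g x = g y")
    case True
    then show ?thesis
      using F(2)[of x "g x" y] in_piece[of x] in_piece[of y] that by (simp add: f_def)
  next
    case False
    then have "g x < g y" using g_mono[of x y] that by simp
    then show ?thesis using len that unfolding omega_pow.simps(2)[of "Suc k"] Field_omega_pow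
      by (auto simp: f_def)
  qed
  ultimately show ?case unfolding bij_betw_def by blast
qed

lemma ordIso_omega_pow:
  fixes S :: "real set"
  assumes f: "bij_betw f S {xs. length xs = k}"
    and mono: "\<And>x y. x \<in> S \<Longrightarrow> y \<in> S \<Longrightarrow> x < y \<Longrightarrow> (f x, f y) \<in> omega_pow k"
  shows "(relation_of (\<le>) S, omega_pow k) \<in> ordIso"
proof -
  let ?R = "relation_of (\<le>) S"
  note W = Well_order_omega_pow[of k]
  have antisym: "antisym (omega_pow k)" and refl: "refl_on (Field (omega_pow k)) (omega_pow k)"
    using W by (auto simp: order_on_defs)
  have iff: "(x, y) \<in> ?R \<longleftrightarrow> (f x, f y) \<in> omega_pow k" if "x \<in> S" "y \<in> S" for x y
  proof (cases x y rule: linorder_cases)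
    case less
    then show ?thesis using mono that by (auto simp: relation_of_def)
  next
    case equal
    then show ?thesis using that refl f
      by (auto simp: relation_of_def refl_on_def Field_omega_pow dest: bij_betwE)
  next
    case greater
    then have "(f y, f x) \<in> omega_pow k" "f x \<noteq> f y"
      using mono that f by (auto simp: bij_betw_def inj_on_def)
    then show ?thesis using greater antisym by (auto simp: relation_of_def antisym_def)
  qed
  have iso: "iso ?R (omega_pow k) f"
    unfolding iso_iff2 Field_relation_of_le Field_omega_pow using f iff by auto
  define h where "h = inv_into S f"
  have h: "bij_betw h {xs. length xs = k} S" unfolding h_def using f by (rule bij_betw_inv_into)
  \<comment> \<open>\<open>ordIso\<close> also demands that \<open>?R\<close> be a well-order; this
    is carried over from \<open>omega_pow k\<close> along the inverse h of f.\<close>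
  have "?R = dir_image (omega_pow k) h"
  proof (intro set_eqI iffI; clarify)
    fix x y assume "(x, y) \<in> ?R"
    then have "x \<in> S" "y \<in> S" "(f x, f y) \<in> omega_pow k" using iff by (auto simp: relation_of_def)
    moreover have "h (f x) = x" "h (f y) = y"
      using calculation f by (auto simp: h_def bij_betw_def)
    ultimately show "(x, y) \<in> dir_image (omega_pow k) h" by (force simp: dir_image_def)
  next
    fix x y assume "(x, y) \<in> dir_image (omega_pow k) h"
    then obtain u v where uv: "x = h u" "y = h v" "(u, v) \<in> omega_pow k" by (auto simp: dir_image_def)
    then have "u \<in> {xs. length xs = k}" "v \<in> {xs. length xs = k}"
      unfolding Field_omega_pow[symmetric] by (auto intro: FieldI1 FieldI2)
    then have "h u \<in> S" "h v \<in> S" "f (h u) = u" "f (h v) = v"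
      using f by (auto simp: h_def bij_betw_def intro!: inv_into_into f_inv_into_f)
    then show "(x, y) \<in> ?R" using iff uv by auto
  qed
  then have "Well_order ?R"
    using Well_order_dir_image[OF W, of h] h by (simp add: Field_omega_pow bij_betw_def)
  then show ?thesis using iso W by (auto simp: ordIso_def)
qed

subsection \<open>Limit points of defects\<close>

text \<open>The numbers \<open>\<delta>(m) + j\<close> with \<open>j \<ge> k\<close> and \<open>\<parallel>m\<parallel> + j \<equiv> a\<close> modulo \<open>3\<close>, with \<open>C = \<parallel>m\<parallel> + j\<close>.\<close>

definition limit_values :: "nat \<Rightarrow> int \<Rightarrow> real set" where
  "limit_values k a = {real C - 3 * log 3 (real m) | C m.
     m > 0 \<and> complexity m + k \<le> C \<and> [int C = a] (mod 3)}"

lemma limit_valuesI: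
  "m > 0 \<Longrightarrow> complexity m + k \<le> C \<Longrightarrow> [int C = a] (mod 3) \<Longrightarrow>
    real C - 3 * log 3 (real m) \<in> limit_values k a"
  unfolding limit_values_def by blast

lemma defect_set_subset_limit_values: "defect_set a \<subseteq> limit_values 0 a"
  unfolding defect_set_def limit_values_def defect_def by auto

text \<open>Lets the computation of derived sets use \<open>limit_values 0 a\<close>, which is
  closed under convenient constructions. The surplus over the true defects has j \<ge> 1 and
  therefore affects k-th derived sets only from k + 1 on.\<close>

lemma limit_values_subset: "limit_values 0 a \<subseteq> defect_set a \<union> limit_values 1 a"
proof
  fix x assume "x \<in> limit_values 0 a"
  then obtain C m where x: "x = real C - 3 * log 3 (real m)" "m > 0" "complexity m \<le> C"
    "[int C = a] (mod 3)" unfolding limit_values_def by auto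
  consider "complexity m + 1 \<le> C" | "complexity m = C" "m \<noteq> 1" | "C = 1" "m = 1"
    using x(3) by force
  then show "x \<in> defect_set a \<union> limit_values 1 a"
  proof cases
    case 1
    then show ?thesis unfolding x(1) using x(2,4) by (intro UnI2 limit_valuesI)
  next
    case 2
    then show ?thesis using x unfolding defect_set_def defect_def by auto
  next
    case 3
    \<comment> \<open>\<open>1\<close> is excluded from \<open>\<D>\<^sup>a\<close>, but \<open>\<delta>(1) = \<delta>(3) + 1\<close>.\<close>
    then have "x = real 4 - 3 * log 3 (real 3)" using x(1) by simp
    moreover have "[int 4 = a] (mod 3)" using x(4) 3 by (simp add: Cong.cong_def)
    ultimately have "x \<in> limit_values 1 a" using limit_valuesI[of 3 1 4 a] by simp
    then show ?thesis by simp
  qed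
qed

text \<open>The three cases of the claimed limit in one formula, as \<open>mod 3\<close> takes
  values 0, 1, 2 also on negative integers.\<close>

definition limit_bound :: "nat \<Rightarrow> int \<Rightarrow> real" where
  "limit_bound k a = real k + real_of_int ((int k - a) mod 3) * defect 2"

lemma limit_values_ge_nat:
  assumes "x \<in> limit_values k a"
  shows "real k \<le> x"
proof -
  obtain C m where x: "x = real C - 3 * log 3 (real m)" "m > 0" "complexity m + k \<le> C"
    using assms unfolding limit_values_def by auto
  then have "x = defect m + (real C - real (complexity m))" by (simp add: defect_def)
  then show ?thesis using defect_nonneg[OF x(2)] x(3) by linarith
qed

lemma limit_bound_less: "limit_bound k a < real k + 1"
proof -
  have "(int k - a) mod 3 \<le> 2" using pos_mod_bound[of 3 "int k - a"] by linarith
  then have "real_of_int ((int k - a) mod 3) * defect 2 \<le> 2 * defect 2"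
    using defect_2_pos by (intro mult_right_mono) auto
  then show ?thesis using two_defect_2_less_1 by (simp add: limit_bound_def)
qed

text \<open>If C exceeds \<parallel>m\<parallel> by exactly k, the residue bound for \<delta>(m)
  applies. A larger excess gives a value of at least k + 1, and 2\<delta>(2) < 1 keeps the bound
  below that.\<close>

lemma limit_values_ge:
  assumes "x \<in> limit_values k a"
  shows "limit_bound k a \<le> x"
proof -
  obtain C m where x: "x = real C - 3 * log 3 (real m)" "m > 0" "complexity m + k \<le> C"
    "[int C = a] (mod 3)"
    using assms unfolding limit_values_def by auto
  show ?thesis
  proof (cases "complexity m + k = C")
    case True
    have "(int k - a) mod 3 = (int k - int C) mod 3"
      using x(4) by (metis Cong.cong_def mod_diff_right_eq)
    also have "int k - int C = - int (complexity m)" using True by simp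
    finally have "limit_bound k a \<le> real k + defect m"
      using defect_residue[OF x(2)] by (simp add: limit_bound_def)
    then show ?thesis using x(1) True by (simp add: defect_def)
  next
    case False
    then have "x \<in> limit_values (Suc k) a"
      unfolding x(1) using x(2-4) by (intro limit_valuesI) auto
    then show ?thesis using limit_values_ge_nat[of x "Suc k" a] limit_bound_less[of k a] by simp
  qed
qed

text \<open>Write the terms as \<delta>(m_i) + j_i. Both summands are bounded, so on a subsequence
  j_i is a constant J \<ge> k and the defects converge as described by tameness. They must increase
  strictly, and then their limit has excess at least 1; together with J this gives
  \<open>Suc k\<close>.\<close>

lemma limit_values_sequence:
  assumes X: "\<And>i. X i \<in> limit_values k a" "\<And>i. X i \<noteq> x" "X \<longlonglongrightarrow> x"
  shows "x \<in> limit_values (Suc k) a" and "\<exists>i. X i < x"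
proof -
  have "\<forall>i. \<exists>C m. X i = real C - 3 * log 3 (real m) \<and> m > 0 \<and> complexity m + k \<le> C \<and> [int C = a] (mod 3)"
    using X(1) unfolding limit_values_def by auto
  then obtain C m where Cm: "\<And>i. X i = real (C i) - 3 * log 3 (real (m i))" "\<And>i. m i > 0"
    "\<And>i. complexity (m i) + k \<le> C i" "\<And>i. [int (C i) = a] (mod 3)" by metis
  define j where "j i = C i - complexity (m i)" for i
  have j: "C i = complexity (m i) + j i" "k \<le> j i" for i using Cm(3)[of i] by (auto simp: j_def)
  have X_eq: "X i = defect (m i) + j i" for i using Cm(1) j(1) by (simp add: defect_def)
  obtain B where B: "X i \<le> B" for i
    using convergent_imp_Bseq[of X] X(3) unfolding Bseq_def convergent_def
    by (metis abs_ge_self order_trans real_norm_def)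
  have "m i \<in> {n. n > 0 \<and> defect n \<le> B}" for i
    using B[of i] Cm(2)[of i] by (simp add: X_eq)
  then obtain r M D where r: "strict_mono r" "convergent_defects (m \<circ> r) M D"
    using tameD[OF tame_defect_le, of m] by metis
  have "j i \<le> nat \<lceil>B\<rceil>" for i
    using B[of i] defect_nonneg[OF Cm(2)[of i]] by (simp add: X_eq) linarith
  then have "range (\<lambda>i. j (r i)) \<subseteq> {..nat \<lceil>B\<rceil>}" by auto
  then have "finite (range (\<lambda>i. j (r i)))" using finite_subset by blast
  then obtain J where "infinite {i. j (r i) = J}"
    using pigeonhole_infinite[of UNIV "\<lambda>i. j (r i)"] by auto
  then obtain s :: "nat \<Rightarrow> nat" where s: "strict_mono s" "\<forall>i. s i \<in> {i. j (r i) = J}"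
    using infinite_enumerate by blast
  define t where "t = r \<circ> s"
  have t: "strict_mono t" using r(1) s(1) unfolding t_def by (rule strict_mono_o)
  have jt: "j (t i) = J" for i using s(2) by (simp add: t_def)
  have conv: "convergent_defects (m \<circ> t) M D"
    using convergent_defects_subseq[OF r(2) s(1)] by (simp add: t_def o_assoc)
  have Xt: "X (t i) = defect (m (t i)) + J" for i by (simp add: X_eq jt)
  have lim: "(\<lambda>i. X (t i)) \<longlonglongrightarrow> x" using LIMSEQ_subseq_LIMSEQ[OF X(3) t] by (simp add: o_def)
  have "(\<lambda>i. X (t i)) \<longlonglongrightarrow> (real D - 3 * log 3 (real M)) + J"
    unfolding Xt using conv by (intro tendsto_add tendsto_const) (auto simp: convergent_defects_def)
  with lim have x: "x = real (D + J) - 3 * log 3 (real M)"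
    using LIMSEQ_unique by fastforce
  have incr: "strict_mono (\<lambda>i. X (t i))" and D: "D > complexity M"
  proof -
    \<comment> \<open>Constant defects would make the subsequence constantly equal to its limit x, a
      value that X avoids.\<close>
    have "\<not> (\<forall>i j. defect ((m \<circ> t) i) = defect ((m \<circ> t) j))"
    proof
      assume *: "\<forall>i j. defect ((m \<circ> t) i) = defect ((m \<circ> t) j)"
      have "X (t i) = X (t 0)" for i using *[rule_format, of i 0] by (simp add: Xt)
      then have "(\<lambda>i. X (t i)) = (\<lambda>_. X (t 0))" by (rule ext)
      then have "(\<lambda>i. X (t i)) \<longlonglongrightarrow> X (t 0)" by (simp only: tendsto_const)
      then show False using lim X(2) LIMSEQ_unique by blast
    qed
    then have "strict_mono (\<lambda>i. defect ((m \<circ> t) i))" "D > complexity M"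
      using conv unfolding convergent_defects_def by blast+
    then show "strict_mono (\<lambda>i. X (t i))" "D > complexity M" by (simp_all add: Xt strict_mono_def)
  qed
  show "\<exists>i. X i < x"
  proof
    have "X (t (Suc 0)) \<le> x"
      using incseq_le[OF strict_mono_mono[OF incr] lim] .
    then show "X (t 0) < x" using strict_monoD[OF incr, of 0 "Suc 0"] by simp
  qed
  have "[complexity (m (t 0)) = D] (mod 3)" using conv by (simp add: convergent_defects_def)
  then have "[C (t 0) = D + J] (mod 3)" unfolding j(1) jt by (rule cong_add) simp
  then have "[int (D + J) = a] (mod 3)"
    using Cm(4)[of "t 0"] unfolding cong_int_iff[symmetric] by (simp add: Cong.cong_def)
  moreover have "complexity M + Suc k \<le> D + J" using D j(2)[of "t 0"] by (simp add: jt)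
  moreover have "M > 0" using conv by (simp add: convergent_defects_def)
  ultimately show "x \<in> limit_values (Suc k) a" unfolding x by (intro limit_valuesI)
qed

section \<open>Derived sets of the limit values and their least elements\<close>

lemma derived_limit_values: "derived (limit_values k a) \<subseteq> limit_values (Suc k) a"
proof
  fix x assume "x \<in> derived (limit_values k a)"
  then obtain X where "\<And>i. X i \<in> limit_values k a - {x}" "X \<longlonglongrightarrow> x"
    unfolding mem_derived islimpt_sequential by blast
  then show "x \<in> limit_values (Suc k) a" by (intro limit_values_sequence(1)[of X]) auto
qed

lemma derived_pow_limit_values: "(derived ^^ k) (limit_values j a) \<subseteq> limit_values (k + j) a"
proof (induction k)
  case (Suc k)
  have "derived ((derived ^^ k) (limit_values j a)) \<subseteq> derived (limit_values (k + j) a)"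
    using derived_pow_mono[OF Suc.IH, of 1] by simp
  then show ?case using derived_limit_values[of "k + j" a] by simp
qed simp

lemma no_right_limits_limit_values: "no_right_limits (limit_values k a)"
  unfolding no_right_limits_def
proof (intro allI notI)
  fix x assume "x islimpt limit_values k a \<inter> {x<..}"
  then obtain X where X: "\<And>i. X i \<in> (limit_values k a \<inter> {x<..}) - {x}" "X \<longlonglongrightarrow> x"
    unfolding islimpt_sequential by blast
  then have "\<exists>i. X i < x" by (intro limit_values_sequence(2)[of X k a]) auto
  then show False using X(1) by (metis DiffD1 IntD2 greaterThan_iff less_asym)
qed

text \<open>Multiply m by 3^n + 1 and raise C by 3n + 1, an upper bound for the complexity of that
  factor. \<open>limit_values 0\<close> only asks that C be at least the complexity, so an efficient
  product is not asked for.\<close>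

lemma limit_values_0_step:
  assumes "x \<in> limit_values 0 a" "n > 0"
  shows "x + (1 - 3 * log 3 (1 + 1 / 3 ^ n)) \<in> limit_values 0 (a + 1)"
proof -
  obtain C m where x: "x = real C - 3 * log 3 (real m)" "m > 0" "complexity m \<le> C"
    "[int C = a] (mod 3)"
    using assms(1) unfolding limit_values_def by auto
  let ?C = "C + (3 * n + 1)" and ?m = "m * (3 ^ n + 1)"
  have "real (3 ^ n + 1) = 3 ^ n * (1 + 1 / 3 ^ n)" by (simp add: field_simps)
  also have "log 3 \<dots> = log 3 (3 ^ n) + log 3 (1 + 1 / 3 ^ n)"
    by (rule log_mult_pos) (auto simp: add_pos_pos)
  also have "log 3 ((3::real) ^ n) = real n" by (simp add: log_nat_power)
  finally have "log 3 (real ?m) = log 3 (real m) + (real n + log 3 (1 + 1 / 3 ^ n))"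
    unfolding of_nat_mult using x(2) by (subst log_mult_pos) (auto simp: add_pos_pos)
  then have "x + (1 - 3 * log 3 (1 + 1 / 3 ^ n)) = real ?C - 3 * log 3 (real ?m)"
    by (simp add: x(1))
  moreover have "complexity ?m \<le> ?C"
    using complexity_mult_le[OF x(2), of "3 ^ n + 1"] complexity_add_le[of "3 ^ n" 1]
      complexity_pow3_le[OF assms(2)] x(3) by simp
  moreover have "[int ?C = a + 1] (mod 3)"
  proof -
    have "[int C + int (3 * n + 1) = a + 1] (mod 3)"
      by (rule cong_add[OF x(4)]) (simp add: Cong.cong_def)
    then show ?thesis by (simp only: of_nat_add)
  qed
  moreover have "?m > 0" using x(2) by simp
  ultimately show ?thesis using limit_valuesI[of ?m 0 ?C "a + 1"] by (simp only: add_0_right)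
qed

text \<open>Translations commute with forming derived sets. The shifts of the preceding lemma tend
  to 1 without reaching it, so x + 1 is a limit of k-th derived points in the next residue class.
  The exponent \<open>Suc n\<close> keeps the power of 3 nontrivial.\<close>

lemma derived_limit_values_step:
  assumes "x \<in> (derived ^^ k) (limit_values 0 a)"
  shows "x + 1 \<in> (derived ^^ Suc k) (limit_values 0 (a + 1))"
proof -
  define t where "t n = 1 - 3 * log 3 (1 + 1 / 3 ^ Suc n)" for n :: nat
  have "x + t n \<in> (derived ^^ k) (limit_values 0 (a + 1))" for n
  proof -
    have "(\<lambda>x. x + t n) ` limit_values 0 a \<subseteq> limit_values 0 (a + 1)"
      using limit_values_0_step[of _ a "Suc n"] unfolding t_def by blast
    then show ?thesis using derived_pow_translate[OF assms, of "t n"] derived_pow_mono by blast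
  qed
  moreover have "x + t n \<noteq> x + 1" for n
  proof -
    have "log 3 (1 + 1 / 3 ^ Suc n) > (0::real)" by (subst zero_less_log_cancel_iff) (auto simp: add_pos_pos)
    then show ?thesis by (simp add: t_def)
  qed
  moreover have "(\<lambda>n. x + t n) \<longlonglongrightarrow> x + 1"
  proof -
    have "(\<lambda>n. 1 / (3::real) ^ Suc n) \<longlonglongrightarrow> 0"
      using LIMSEQ_Suc[OF LIMSEQ_inverse_realpow_zero[of "3::real"]] by (simp add: field_simps)
    then have "(\<lambda>n. log 3 (1 + 1 / (3::real) ^ Suc n)) \<longlonglongrightarrow> log 3 (1 + 0)"
      by (intro tendsto_log tendsto_add tendsto_const) auto
    then have "(\<lambda>n. x + t n) \<longlonglongrightarrow> x + (1 - 3 * log 3 (1 + 0))"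
      unfolding t_def by (intro tendsto_add tendsto_diff tendsto_mult tendsto_const)
    then show ?thesis by simp
  qed
  ultimately have "x + 1 islimpt (derived ^^ k) (limit_values 0 (a + 1))"
    unfolding islimpt_sequential by (intro exI[of _ "\<lambda>n. x + t n"]) auto
  then show ?thesis by (simp add: mem_derived)
qed

lemma limit_bound_mem_limit_values: "limit_bound k a \<in> (derived ^^ k) (limit_values 0 a)"
proof (induction k arbitrary: a)
  case 0
  \<comment> \<open>The witness is 3 \<cdot> 2^r with C = 3 + 2r, which is congruent to -r and hence
    to a, and whose value is r\<delta>(2). The factor 3 adds no defect and covers r = 0, where 2^0 =
    1 would have complexity 1 instead of 0.\<close>
  define r where "r = nat ((- a) mod 3)"
  have r: "int r = (- a) mod 3" unfolding r_def by simp
  have pow: "complexity (3 * 2 ^ n) \<le> 3 + 2 * n" for n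
  proof (induction n)
    case (Suc n)
    then show ?case using complexity_mult_le[of 2 "3 * 2 ^ n"] by (simp add: mult.left_commute)
  qed simp
  have "log 3 (real (3 * 2 ^ r)) = 1 + real r * log 3 2"
    by (simp add: log_mult log_nat_power)
  then have "limit_bound 0 a = real (3 + 2 * r) - 3 * log 3 (real (3 * 2 ^ r))"
    using r by (simp add: limit_bound_def defect_2 algebra_simps flip: r)
  moreover have "[int (3 + 2 * r) = a] (mod 3)"
    using r unfolding Cong.cong_def by simp presburger
  ultimately show ?case
    using pow[of r] limit_valuesI[of "3 * 2 ^ r" 0 "3 + 2 * r" a] by simp
next
  case (Suc k)
  have "limit_bound (Suc k) a = limit_bound k (a - 1) + 1"
    by (simp add: limit_bound_def algebra_simps)
  then show ?case using derived_limit_values_step[OF Suc.IH[of "a - 1"]] by simp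
qed

lemma has_initial_limit_defect_set: "has_initial_limit (defect_set a) k (limit_bound k a)"
proof -
  let ?D = "defect_set a" and ?L = "limit_bound k a"
  have nrl: "no_right_limits ?D"
    using no_right_limits_limit_values defect_set_subset_limit_values by (rule no_right_limits_subset)
  have ge: "?L \<le> x" if "x \<in> (derived ^^ k) ?D" for x
    using that derived_pow_mono[OF defect_set_subset_limit_values, of k a] derived_pow_limit_values[of k 0 a]
    by (intro limit_values_ge[of x k a]) auto
  have L: "?L \<in> (derived ^^ k) ?D"
  proof -
    have "?L \<in> (derived ^^ k) (?D \<union> limit_values 1 a)"
      using limit_bound_mem_limit_values[of k a] derived_pow_mono[OF limit_values_subset, of k a] by blast
    \<comment> \<open>The k-th derived set of the surplus lies at or above k + 1, beyond L, so L
      must come from the defects themselves.\<close>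
    moreover have "?L \<notin> (derived ^^ k) (limit_values 1 a)"
      using derived_pow_limit_values[of k 1 a] limit_values_ge_nat[of ?L "k + 1" a] limit_bound_less[of k a]
      by auto
    ultimately show ?thesis by (simp add: derived_pow_Un)
  qed
  show ?thesis
  proof (cases k)
    case 0
    \<comment> \<open>For k = 0 the segment consists of L alone, the least defect in the
      class.\<close>
    have seg: "initial_segment ?D {?L}"
      using L ge 0 by (auto simp: initial_segment_def) (meson leD)
    have "(relation_of (\<le>) {?L}, omega_pow k) \<in> ordIso"
      by (rule ordIso_omega_pow[of "\<lambda>_. []"]) (auto simp: 0 bij_betw_def)
    then show ?thesis using seg unfolding has_initial_limit_def by (intro exI[of _ "{?L}"]) auto
  next
    case (Suc j)
    define S where "S = ?D \<inter> {..<?L}"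
    have S_nrl: "no_right_limits S" using nrl by (rule no_right_limits_subset) (simp add: S_def)
    have "?D = S \<union> (?D \<inter> {?L..})" by (auto simp: S_def)
    \<comment> \<open>Defects at or above L could reach L only as a limit from the right, so the
      part S below L already has L in its k-th derived set.\<close>
    moreover have "?L \<notin> (derived ^^ k) (?D \<inter> {?L..})"
      by (rule not_in_derived_pow_atLeast[OF no_right_limits_subset[OF nrl]]) (auto simp: Suc)
    ultimately have LS: "?L \<in> (derived ^^ k) S" using L by (metis Un_iff derived_pow_Un)
    have "(derived ^^ k) S \<subseteq> {..?L}" by (intro derived_pow_subset_closed) (auto simp: S_def)
    then have eq: "(derived ^^ Suc j) S = {?L}"
      using LS ge derived_pow_mono[of S ?D k] unfolding Suc S_def by fastforce
    have "?D \<subseteq> {0..}"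
      using limit_values_ge_nat[of _ 0 a] defect_set_subset_limit_values[of a] by auto
    then have sub: "S \<subseteq> {0..<?L}" by (auto simp: S_def)
    obtain f where "bij_betw f S {xs. length xs = Suc j}"
      "\<forall>x\<in>S. \<forall>y\<in>S. x < y \<longrightarrow> (f x, f y) \<in> omega_pow (Suc j)"
      using omega_pow_embedding[OF sub S_nrl eq] by blast
    then have iso: "(relation_of (\<le>) S, omega_pow k) \<in> ordIso"
      unfolding Suc by (intro ordIso_omega_pow) auto
    have seg: "initial_segment ?D S" by (auto simp: initial_segment_def S_def)
    have bdd: "bdd_above S" by (rule bdd_aboveI[of _ ?L]) (simp add: S_def)
    have "Sup S = ?L"
    proof (rule antisym)
      have "S \<noteq> {}" using derived_pow_subset_closed[of "{}" S "Suc j"] eq by auto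
      then show "Sup S \<le> ?L" by (rule cSup_least) (simp add: S_def)
      have "(derived ^^ k) S \<subseteq> {..Sup S}"
        by (intro derived_pow_subset_closed) (auto intro: cSup_upper bdd)
      then show "?L \<le> Sup S" using LS by auto
    qed
    then show ?thesis using seg iso bdd unfolding has_initial_limit_def by blast
  qed
qed

theorem theorem1p9:
  fixes k :: nat and a :: int
  shows "([int k - a = 0] (mod 3) \<longrightarrow> has_initial_limit (defect_set a) k (real k))
       \<and> ([int k - a = 1] (mod 3) \<longrightarrow> has_initial_limit (defect_set a) k (real k + defect 2))
       \<and> ([int k - a = 2] (mod 3) \<longrightarrow> has_initial_limit (defect_set a) k (real k + 2 * defect 2))"
  using has_initial_limit_defect_set[of a k] by (auto simp: limit_bound_def Cong.cong_def)

end
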